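(* Let $(X,d)$ be a complete length space and $T>0$. Assume that $H\in C(X\times(0,T)\times[0,\infty))$ satisfies (H1) and that the associated Lagrangian $L(x,t,q)=\sup_{p\ge0}\{pq-H(x,t,p)\}$ belongs to $C(X\times(0,T)\times[0,\infty))$ and satisfies (H2)--(H5), where (H1)--(H5) are the conditions listed in the context. Let $u_0:X\to\mathbb{R}$ be bounded and Lipschitz. Then there exists a unique bounded Monge solution $u\in\mathrm{Lip}(X\times[0,T))$ of $$\partial_tu+H(x,t,|\nabla u|)=0\quad\text{in }X\times(0,T)$$ satisfying $$\sup_{x\in X}|u(x,t)-u_0(x)|\to0\quad\text{as }t\to0+.$$
   Context: Conditions: (H1) $p\mapsto H(x,t,p)$ is convex and nondecreasing in $[0,\infty)$ for all $(x,t)\in X\times(0,T)$, and $\inf\{H(x,t,p)/p:(x,t)\in X\times(0,T),\ p\ge R\}\to\infty$ as $R\to\infty$. (H2) There is a convex function $m\in C(\mathbb{R})$ with $\inf_{(x,t)\in X\times(0,T)}L(x,t,q)\ge m(q)$ for all $q\ge0$ and $m(q)/q\to\infty$ as $q\to\infty$. (H3) $\sup_{(x,t)\in X\times(0,T)}L(x,t,0)<+\infty$. (H4) $L$ is locally uniformly continuous (uniformly continuous on bounded subsets) in $X\times(0,T)\times[0,\infty)$, and there is a modulus of continuity $\omega_L$ such that $|L(x,t,q)-L(y,s,q)|\le\omega_L(d(x,y)+|t-s|)(1+|m(q)|)$ for all $x,y\in X$, $t,s\in(0,T)$, $q\ge0$, with $m$ as in (H2). (H5) There is $C_T>0$ such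 that $|L(x,t,q)-L(x,s,q)|\le C_T|t-s|$ for all $x\in X$, $t,s\in(0,T)$, $q\ge0$. Write $Y_T=X\times(0,T)$; space-time carries the metric $\bar d((x_1,t_1),(x_2,t_2))=\max\{d(x_1,x_2),|t_1-t_2|\}$. $\mathrm{Lip}$ and $\mathrm{Lip}_{loc}$ denote Lipschitz and locally Lipschitz real functions. For $k\ge0$, $S_k(Y_T)=\{u\in\mathrm{Lip}_{loc}(Y_T):u(x,t)-u(x,s)\ge-k(t-s)\ \forall x\in X,\ 0<s<t<T\}$, and $S(Y_T)=\bigcup_{k\ge0}S_k(Y_T)$. For $v\in S_0(Y_T)$ and $(x,t)\in Y_T$, $$|D_L^-v|(x,t)=\limsup_{y\to x,\ s\to t-}\left\{\frac{v(x,t)-v(y,s)}{t-s}-L\left(x,t,\frac{d(x,y)}{t-s}\right)\right\},$$ the limsup being over $(y,s)\in Y_T$ with $s<t$ ($y=x$ allowed) and $(y,s)\to(x,t)$. Definition: $u\in S(Y_T)$ is a Monge solution of $\partial_tu+H(x,t,|\nabla u|)=0$ if there is $k\ge0$ with $u\in S_k(Y_T)$ such that $v(x,t)=u(x,t)+kt$ satisfies $|D_L^-v|(x,t)=k$ for every $(x,t)\in Y_T$. A function on $X\times[0,T)$ is called a Monge solution if its restriction to $Y_T$ is. *)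

theory Defs
  imports "HOL-Analysis.Analysis"
begin

definition curve_length :: "(real \<Rightarrow> 'a::metric_space) \<Rightarrow> ereal" where
  "curve_length g =
     (SUP (n, \<tau>) \<in> {(n, \<tau>). mono_on {..n} \<tau> \<and> \<tau> ` {..n} \<subseteq> {0..1}}.
        ereal (\<Sum>i<(n::nat). dist (g (\<tau> i)) (g (\<tau> (Suc i)))))"

text \<open>The infimum is taken in the extended reals, so the condition also forces any two points to be
  joined by a curve of finite length.\<close>

definition length_space :: "'a::metric_space itself \<Rightarrow> bool" where
  "length_space _ \<longleftrightarrow>
     (\<forall>x y::'a. ereal (dist x y) =
        (INF g \<in> {g. path g \<and> pathstart g = x \<and> pathfinish g = y}. curve_length g))"

text \<open>\<open>H x t p\<close> and \<open>L x t q\<close> are relevant only for \<open>0 < t < T\<close> and \<open>p, q \<ge> 0\<close>; the values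
  elsewhere play no role.\<close>

definition jointly_continuous :: "real \<Rightarrow> ('a::metric_space \<Rightarrow> real \<Rightarrow> real \<Rightarrow> real) \<Rightarrow> bool" where
  "jointly_continuous T F \<longleftrightarrow>
     continuous_on (UNIV \<times> {0<..<T} \<times> {0..}) (\<lambda>(x, t, p). F x t p)"

text \<open>A supremum of reals. Under \<open>cond_H1\<close> and continuity of \<open>H\<close> the set is bounded above for every
  \<open>q \<ge> 0\<close>, by superlinearity, so this is the true supremum.\<close>

definition Lagrangian :: "('a \<Rightarrow> real \<Rightarrow> real \<Rightarrow> real) \<Rightarrow> 'a \<Rightarrow> real \<Rightarrow> real \<Rightarrow> real" where
  "Lagrangian H x t q = (SUP p\<in>{0..}. p * q - H x t p)"

definition cond_H1 :: "real \<Rightarrow> ('a \<Rightarrow> real \<Rightarrow> real \<Rightarrow> real) \<Rightarrow> bool" where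
  "cond_H1 T H \<longleftrightarrow>
     (\<forall>x. \<forall>t\<in>{0<..<T}. convex_on {0..} (H x t) \<and> mono_on {0..} (H x t)) \<and>
     ((\<lambda>R. INF (x, t, p) \<in> UNIV \<times> {0<..<T} \<times> {R..}. ereal (H x t p / p)) \<longlongrightarrow> \<infinity>) at_top"

definition cond_H2 ::
    "real \<Rightarrow> ('a \<Rightarrow> real \<Rightarrow> real \<Rightarrow> real) \<Rightarrow> (real \<Rightarrow> real) \<Rightarrow> bool" where
  "cond_H2 T L m \<longleftrightarrow>
     convex_on UNIV m \<and> continuous_on UNIV m \<and>
     (\<forall>q\<ge>0. ereal (m q) \<le> (INF (x, t) \<in> UNIV \<times> {0<..<T}. ereal (L x t q))) \<and>
     filterlim (\<lambda>q. m q / q) at_top at_top"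

definition cond_H3 :: "real \<Rightarrow> ('a \<Rightarrow> real \<Rightarrow> real \<Rightarrow> real) \<Rightarrow> bool" where
  "cond_H3 T L \<longleftrightarrow> (SUP (x, t) \<in> UNIV \<times> {0<..<T}. ereal (L x t 0)) < \<infinity>"

definition modulus_of_continuity :: "(real \<Rightarrow> real) \<Rightarrow> bool" where
  "modulus_of_continuity \<omega> \<longleftrightarrow>
     continuous_on {0..} \<omega> \<and> mono_on {0..} \<omega> \<and> \<omega> 0 = 0"

definition cond_H4 ::
    "real \<Rightarrow> ('a::metric_space \<Rightarrow> real \<Rightarrow> real \<Rightarrow> real) \<Rightarrow> (real \<Rightarrow> real) \<Rightarrow> bool" where
  "cond_H4 T L m \<longleftrightarrow>
     (\<forall>B \<subseteq> UNIV \<times> {0<..<T} \<times> {0..}. bounded B \<longrightarrow>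
        uniformly_continuous_on B (\<lambda>(x, t, q). L x t q)) \<and>
     (\<exists>\<omega>. modulus_of_continuity \<omega> \<and>
        (\<forall>x y. \<forall>t\<in>{0<..<T}. \<forall>s\<in>{0<..<T}. \<forall>q\<ge>0.
           \<bar>L x t q - L y s q\<bar> \<le> \<omega> (dist x y + \<bar>t - s\<bar>) * (1 + \<bar>m q\<bar>)))"

definition cond_H5 :: "real \<Rightarrow> ('a \<Rightarrow> real \<Rightarrow> real \<Rightarrow> real) \<Rightarrow> bool" where
  "cond_H5 T L \<longleftrightarrow>
     (\<exists>C>0. \<forall>x. \<forall>t\<in>{0<..<T}. \<forall>s\<in>{0<..<T}. \<forall>q\<ge>0.
        \<bar>L x t q - L x s q\<bar> \<le> C * \<bar>t - s\<bar>)"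

text \<open>The library metric on \<open>'a \<times> real\<close> is \<open>sqrt (d\<^sup>2 + \<bar>t - s\<bar>\<^sup>2)\<close>, which lies between the maximum
  metric \<open>max d \<bar>t - s\<bar>\<close> and \<open>sqrt 2\<close> times it. It therefore gives the same topology, and the same
  functions are (locally) Lipschitz; see \<open>Lip_iff_max\<close>.\<close>

definition Lip :: "'b::metric_space set \<Rightarrow> ('b \<Rightarrow> real) \<Rightarrow> bool" where
  "Lip S u \<longleftrightarrow> (\<exists>C. C-lipschitz_on S u)"

definition Lip_loc :: "'b::metric_space set \<Rightarrow> ('b \<Rightarrow> real) \<Rightarrow> bool" where
  "Lip_loc S u \<longleftrightarrow> (\<forall>z\<in>S. \<exists>r>0. Lip (ball z r \<inter> S) u)"

lemma Lip_iff_max: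
  fixes u :: "'a::metric_space \<times> real \<Rightarrow> real"
  shows "Lip S u \<longleftrightarrow> (\<exists>C\<ge>0. \<forall>z\<in>S. \<forall>w\<in>S.
           \<bar>u z - u w\<bar> \<le> C * max (dist (fst z) (fst w)) \<bar>snd z - snd w\<bar>)"
proof
  assume "Lip S u"
  then obtain C where C: "C \<ge> 0" "\<And>z w. z \<in> S \<Longrightarrow> w \<in> S \<Longrightarrow> \<bar>u z - u w\<bar> \<le> C * dist z w"
    by (auto simp: Lip_def lipschitz_on_def dist_real_def)
  have d: "dist z w \<le> 2 * max (dist (fst z) (fst w)) \<bar>snd z - snd w\<bar>" for z w :: "'a \<times> real"
  proof -
    have "dist z w \<le> dist (fst z) (fst w) + \<bar>snd z - snd w\<bar>"
      using sqrt_sum_squares_le_sum[of "dist (fst z) (fst w)" "\<bar>snd z - snd w\<bar>"]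
      by (simp add: dist_prod_def dist_real_def)
    then show ?thesis
      unfolding max_def by (cases "dist (fst z) (fst w) \<le> \<bar>snd z - snd w\<bar>") auto
  qed
  have "\<bar>u z - u w\<bar> \<le> (C * 2) * max (dist (fst z) (fst w)) \<bar>snd z - snd w\<bar>"
    if "z \<in> S" "w \<in> S" for z w
    using C(2)[OF that] mult_left_mono[OF d[of z w] C(1)] by (simp add: mult.assoc)
  then show "\<exists>C\<ge>0. \<forall>z\<in>S. \<forall>w\<in>S.
           \<bar>u z - u w\<bar> \<le> C * max (dist (fst z) (fst w)) \<bar>snd z - snd w\<bar>"
    using C(1) by (intro exI[of _ "C * 2"]) auto
next
  assume "\<exists>C\<ge>0. \<forall>z\<in>S. \<forall>w\<in>S.
           \<bar>u z - u w\<bar> \<le> C * max (dist (fst z) (fst w)) \<bar>snd z - snd w\<bar>"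
  then obtain C where C: "C \<ge> 0" "\<And>z w. z \<in> S \<Longrightarrow> w \<in> S \<Longrightarrow>
       \<bar>u z - u w\<bar> \<le> C * max (dist (fst z) (fst w)) \<bar>snd z - snd w\<bar>"
    by blast
  have d: "max (dist (fst z) (fst w)) \<bar>snd z - snd w\<bar> \<le> dist z w" for z w :: "'a \<times> real"
    using dist_fst_le[of z w] dist_snd_le[of z w] by (simp add: dist_real_def)
  have "\<bar>u z - u w\<bar> \<le> C * dist z w" if "z \<in> S" "w \<in> S" for z w
    using C(2)[OF that] mult_left_mono[OF d[of z w] C(1)] by linarith
  then show "Lip S u"
    using C(1) by (auto simp: Lip_def lipschitz_on_def dist_real_def)
qed

definition space_time :: "real \<Rightarrow> ('a \<times> real) set" where
  "space_time T = UNIV \<times> {0<..<T}"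

definition S_class :: "real \<Rightarrow> real \<Rightarrow> ('a::metric_space \<times> real \<Rightarrow> real) set" where
  "S_class T k = {u. Lip_loc (space_time T) u \<and>
     (\<forall>x s t. 0 < s \<and> s < t \<and> t < T \<longrightarrow> u (x, t) - u (x, s) \<ge> - k * (t - s))}"

definition S_union :: "real \<Rightarrow> ('a::metric_space \<times> real \<Rightarrow> real) set" where
  "S_union T = (\<Union>k\<in>{0..}. S_class T k)"

definition Monge_slope ::
    "real \<Rightarrow> ('a::metric_space \<Rightarrow> real \<Rightarrow> real \<Rightarrow> real) \<Rightarrow> ('a \<times> real \<Rightarrow> real) \<Rightarrow> 'a \<Rightarrow> real \<Rightarrow> ereal"
  where
  "Monge_slope T L v x t =
     Limsup (at (x, t) within {(y, s). (y, s) \<in> space_time T \<and> s < t})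
       (\<lambda>(y, s). ereal ((v (x, t) - v (y, s)) / (t - s) - L x t (dist x y / (t - s))))"

text \<open>Depends only on the values of \<open>u\<close> on \<open>space_time T\<close>, so it applies verbatim to
  functions given on \<open>UNIV \<times> {0..<T}\<close>.\<close>

definition Monge_solution ::
    "real \<Rightarrow> ('a::metric_space \<Rightarrow> real \<Rightarrow> real \<Rightarrow> real) \<Rightarrow> ('a \<times> real \<Rightarrow> real) \<Rightarrow> bool" where
  "Monge_solution T H u \<longleftrightarrow>
     u \<in> S_union T \<and>
     (\<exists>k\<ge>0. u \<in> S_class T k \<and>
        (\<forall>(x, t)\<in>space_time T.
           Monge_slope T (Lagrangian H) (\<lambda>(y, s). u (y, s) + k * s) x t = ereal k))"

definition bounded_Monge_solution_with_data ::
    "real \<Rightarrow> ('a::metric_space \<Rightarrow> real \<Rightarrow> real \<Rightarrow> real) \<Rightarrow> ('a \<Rightarrow> real) \<Rightarrow> ('a \<times> real \<Rightarrow> real) \<Rightarrow> bool"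
  where
  "bounded_Monge_solution_with_data T H u0 u \<longleftrightarrow>
     bounded (u ` (UNIV \<times> {0..<T})) \<and>
     Lip (UNIV \<times> {0..<T}) u \<and>
     Monge_solution T H u \<and>
     ((\<lambda>t. SUP x. ereal \<bar>u (x, t) - u0 x\<bar>) \<longlongrightarrow> 0) (at_right 0)"

end

theory Submission
  imports Defs
begin

text \<open>In the slope \<open>|D\<^sub>L\<^sup>- v|\<close> of \<open>v = u + k t\<close> the constant \<open>k\<close> cancels against the right-hand side. So the
  Monge equation says two things about \<open>u\<close> at each point \<open>(x, t)\<close>: up to an error \<open>\<epsilon> (t - s)\<close>, the
  inequality \<open>u(x, t) - u(y, s) \<le> (t - s) L(x, t, d(x, y) / (t - s))\<close> holds for \<^emph>\<open>all\<close> earlier points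
  \<open>(y, s)\<close> close to \<open>(x, t)\<close>, and the reverse inequality holds for \<^emph>\<open>some\<close> earlier points arbitrarily
  close to \<open>(x, t)\<close> (\<open>Monge_slope_eq_iff\<close>).

  \<^bold>\<open>Uniqueness.\<close> Because one inequality holds at all nearby earlier points and the other at
  arbitrarily near ones, both hold at a common point: given solutions \<open>u\<close> and \<open>w\<close>, from every
  \<open>(x, t)\<close> there is a step back in time along which \<open>u - w\<close> drops by at most \<open>2 \<epsilon> (t - s)\<close>. The
  Lipschitz bound on \<open>w\<close> and the superlinearity of \<open>L\<close> bound the speed \<open>d(x, y) / (t - s)\<close> of these
  steps, so infinite sequences of steps converge in the complete space, and repeated steps lead
  down to \<open>t = 0\<close> (\<open>descend_to_initial_time\<close>). Hence \<open>u - w \<le> 2 \<epsilon> t\<close>, and \<open>\<epsilon>\<close> is arbitrary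
  (\<open>Monge_comparison\<close>).

  \<^bold>\<open>Existence.\<close> The solution is a Perron supremum. Fix a maximal speed \<open>Q\<close>. A function \<open>f\<close> is
  \<^emph>\<open>dominated\<close> if \<open>f(x, t) \<le> f(y, s) + (t - s) c\<close> whenever \<open>d(y, x) < q (t - s)\<close>, \<open>q \<le> Q\<close> and \<open>c\<close> bounds
  \<open>L(\<cdot>, \<cdot>, q)\<close> from above on the causal diamond of speed \<open>q\<close> between the two points. Suprema of dominated
  functions are dominated. As a length space allows a step to be cut at any intermediate time
  into two steps inside the same diamond, a dominated function may also be raised to a larger one
  on a set closed under going back in time, provided that the new one is dominated there and lies
  below at the earliest time (\<open>paste_dominated\<close>). The largest dominated function below \<open>u\<^sub>0\<close> at time
  \<open>0\<close> therefore lies above every competitor obtained by pasting, and its properties follow by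
  choosing competitors:
  \<^item> a barrier \<open>u\<^sub>0 - C\<^sub>0 t\<close> controls the growth near \<open>t = 0\<close>, and a delayed copy of the supremum
    gives Lipschitz continuity in time; a step of speed \<open>2\<close> then turns this into Lipschitz
    continuity in space. The Lipschitz constant \<open>K\<close> does not depend on \<open>Q\<close>.
  \<^item> If the supersolution inequality failed at \<open>(x\<^sub>0, t\<^sub>0)\<close>, the function
    \<open>b - (t\<^sub>0 - t) (L(x\<^sub>0, t\<^sub>0, d(x\<^sub>0, x) / (t\<^sub>0 - t)) - \<epsilon> / 2)\<close> on a small backward cone, with \<open>b\<close>
    slightly above the value of the supremum at the tip, would be a competitor exceeding it there
    (\<open>perron_supersolution\<close>). That it is dominated is the convexity and monotonicity of \<open>L\<close> in the speed (\<open>perspective_subadditive\<close>).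
  \<^item> The subsolution inequality holds for speeds below \<open>Q\<close> by domination and the oscillation
    estimate for \<open>L\<close>, and for speeds \<open>q \<ge> Q\<close> because then \<open>K (q + 1) \<le> L(x, t, q)\<close> by
    superlinearity, once \<open>Q\<close> is chosen large in terms of \<open>K\<close> (\<open>perron_subsolution\<close>).\<close>

section \<open>Length spaces and convexity\<close>

lemma dist_Pair_le_sum: "dist (x, t) (y, s) \<le> dist x y + \<bar>t - s\<bar>" for t s :: real
  using sqrt_sum_squares_le_sum[of "dist x y" "\<bar>t - s\<bar>"]
  by (simp add: dist_prod_def dist_real_def)

text \<open>A nearly shortest curve from \<open>y\<close> to \<open>x\<close> passes, by the intermediate value theorem, through a
  point at a prescribed distance from \<open>y\<close>; the rest of the curve is then short enough.\<close>

lemma length_space_split: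
  fixes x y :: "'a::metric_space"
  assumes ls: "length_space TYPE('a)" and d: "dist y x < q * (a + b)"
    and a: "a > 0" and b: "b > 0"
  shows "\<exists>z. dist y z < q * a \<and> dist z x < q * b"
proof -
  have "0 < q * (a + b)" using d zero_le_dist[of y x] by linarith
  then have q: "q > 0" using a b by (simp add: zero_less_mult_iff)
  have "(INF g \<in> {g. path g \<and> pathstart g = y \<and> pathfinish g = x}. curve_length g)
        < ereal (q * (a + b))"
    using ls d unfolding length_space_def by (metis less_ereal.simps(1))
  then obtain g where g: "path g" "pathstart g = y" "pathfinish g = x"
    and "curve_length g < ereal (q * (a + b))"
    by (auto simp: INF_less_iff)
  then obtain l where l: "curve_length g < ereal l" "l < q * (a + b)"
    using ereal_dense2 less_ereal.simps(1) by metis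
  have g01: "g 0 = y" "g 1 = x"
    using g(2,3) by (auto simp: pathstart_def pathfinish_def)
  have through: "dist y (g \<tau>) + dist (g \<tau>) x \<le> l" if "0 \<le> \<tau>" "\<tau> \<le> 1" for \<tau>
  proof -
    define \<sigma> :: "nat \<Rightarrow> real" where "\<sigma> = (\<lambda>i. if i = 0 then 0 else if i = 1 then \<tau> else 1)"
    have "mono_on {..2} \<sigma>" "\<sigma> ` {..2} \<subseteq> {0..1}"
      using that by (auto simp: \<sigma>_def mono_on_def)
    then have "ereal (\<Sum>i<(2::nat). dist (g (\<sigma> i)) (g (\<sigma> (Suc i)))) \<le> curve_length g"
      unfolding curve_length_def
      by (intro SUP_upper2[of "(2, \<sigma>)"]) auto
    moreover have "(\<Sum>i<(2::nat). dist (g (\<sigma> i)) (g (\<sigma> (Suc i)))) = dist y (g \<tau>) + dist (g \<tau>) x"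
      by (simp add: \<sigma>_def g01 numeral_2_eq_2)
    ultimately show ?thesis using l(1) by (metis ereal_less_eq(3) order_le_less_trans less_imp_le)
  qed
  define \<eta> where "\<eta> = q * (a + b) - l"
  \<comment> \<open>The slack \<open>\<eta>\<close> of the curve is shared between the two strict inequalities.\<close>
  define v where "v = max 0 (q * a - \<eta> / 2)"
  have \<eta>: "\<eta> > 0" using l by (simp add: \<eta>_def)
  have v: "0 \<le> v" "v < q * a" "q * a - \<eta> / 2 \<le> v"
    using q a \<eta> by (auto simp: v_def)
  show ?thesis
  proof (cases "dist y x < v")
    case True
    then have "dist y x < q * a" using v by linarith
    then show ?thesis using q b by (intro exI[of _ x]) auto
  next
    case False
    have "continuous_on {0..1} (\<lambda>\<tau>. dist y (g \<tau>))"
      using g(1) by (auto simp: path_def intro!: continuous_intros)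
    then obtain \<tau> where \<tau>: "0 \<le> \<tau>" "\<tau> \<le> 1" "dist y (g \<tau>) = v"
      using IVT'[of "\<lambda>\<tau>. dist y (g \<tau>)" 0 v 1] False v(1) g01 by auto
    have "dist (g \<tau>) x \<le> l - v" using through[OF \<tau>(1,2)] \<tau>(3) by linarith
    also have "l = q * a + q * b - \<eta>" by (simp add: \<eta>_def distrib_left)
    also have "q * a + q * b - \<eta> - v < q * b" using v(3) \<eta> by linarith
    finally show ?thesis using \<tau>(3) v(2) by (intro exI[of _ "g \<tau>"]) auto
  qed
qed

text \<open>The perspective \<open>(d, a) \<mapsto> a \<phi>(d / a)\<close> of a convex function is subadditive; monotonicity of \<open>\<phi>\<close>
  allows the distance \<open>e\<close> to be anything up to the sum of the two distances. The last hypothesis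
  gives the perspective the value \<open>0\<close> at \<open>a = 0\<close>, which is the tip of a cone below.\<close>

lemma perspective_subadditive:
  fixes \<phi> :: "real \<Rightarrow> real"
  assumes cvx: "convex_on {0..} \<phi>" and mono: "mono_on {0..} \<phi>"
    and "0 \<le> a" "0 < h" "0 \<le> d" "0 \<le> q" "0 \<le> e" "e \<le> d + q * h" and z: "a = 0 \<Longrightarrow> d = 0"
  shows "(a + h) * \<phi> (e / (a + h)) \<le> a * \<phi> (d / a) + h * \<phi> q"
proof (cases "a = 0")
  case True
  have "\<phi> (e / h) \<le> \<phi> q"
    by (rule mono_onD[OF mono]) (use assms True in \<open>auto simp: field_simps\<close>)
  then show ?thesis using True assms by simp
next
  case False
  with assms have a: "a > 0" by simp
  have "\<phi> (e / (a + h)) \<le> \<phi> ((d + q * h) / (a + h))"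
    by (rule mono_onD[OF mono]) (use assms a in \<open>auto simp: divide_right_mono\<close>)
  also have "(d + q * h) / (a + h) = (1 - h / (a + h)) *\<^sub>R (d / a) + (h / (a + h)) *\<^sub>R q"
  proof -
    have "1 - h / (a + h) = a / (a + h)" using a \<open>0 < h\<close> by (simp add: field_simps)
    then show ?thesis using a by (simp add: add_divide_distrib mult.commute)
  qed
  also have "\<phi> \<dots> \<le> (1 - h / (a + h)) * \<phi> (d / a) + h / (a + h) * \<phi> q"
    using cvx a assms by (intro convex_onD) (auto simp: field_simps)
  finally have "(a + h) * \<phi> (e / (a + h))
      \<le> (a + h) * ((1 - h / (a + h)) * \<phi> (d / a) + h / (a + h) * \<phi> q)"
    using a \<open>0 < h\<close> by (intro mult_left_mono) auto
  also have "\<dots> = a * \<phi> (d / a) + h * \<phi> q"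
  proof -
    have "(a + h) * (1 - h / (a + h)) = a" "(a + h) * (h / (a + h)) = h"
      using a \<open>0 < h\<close> by (auto simp: field_simps)
    then show ?thesis by (metis (no_types, lifting) distrib_left mult.assoc)
  qed
  finally show ?thesis .
qed

section \<open>The Monge equation as two one-sided inequalities\<close>

text \<open>Since \<open>k t - k s\<close> contributes exactly \<open>k\<close> to the difference quotient, the value \<open>k\<close> of the slope
  expresses that the quotient of \<open>u\<close> alone has upper limit \<open>0\<close>. The two conjuncts are the upper and
  the lower bound for this upper limit, multiplied by \<open>t - s\<close>.\<close>

lemma Monge_slope_eq_iff:
  fixes u :: "'a::metric_space \<times> real \<Rightarrow> real"
  assumes t: "0 < t" "t < T"
  shows "Monge_slope T L (\<lambda>(y, s). u (y, s) + k * s) x t = ereal k \<longleftrightarrow>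
    (\<forall>\<epsilon>>0. \<exists>\<delta>>0. \<forall>y s. 0 < s \<and> s < t \<and> dist (y, s) (x, t) < \<delta> \<longrightarrow>
        u (x, t) - u (y, s) \<le> (t - s) * (L x t (dist x y / (t - s)) + \<epsilon>)) \<and>
    (\<forall>\<epsilon>>0. \<forall>\<delta>>0. \<exists>y s. 0 < s \<and> s < t \<and> dist (y, s) (x, t) < \<delta> \<and>
        u (x, t) - u (y, s) \<ge> (t - s) * (L x t (dist x y / (t - s)) - \<epsilon>))"
  (is "?M \<longleftrightarrow> ?sub \<and> ?super")
proof -
  define F where "F = at (x, t) within {(y, s). (y, s) \<in> space_time T \<and> s < t}"
  define g where "g y s = (u (x, t) - u (y, s)) / (t - s) - L x t (dist x y / (t - s))"
    for y :: 'a and s :: real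
  define X where "X = (\<lambda>(y::'a, s). ereal ((u (x, t) + k * t - (u (y, s) + k * s)) / (t - s)
    - L x t (dist x y / (t - s))))"
  have slope: "Monge_slope T L (\<lambda>(y, s). u (y, s) + k * s) x t = Limsup F X"
    unfolding Monge_slope_def X_def F_def by (simp add: case_prod_beta)
  have X: "X (y, s) = ereal (g y s + k)" if "s < t" for y s
    using that by (simp add: X_def g_def field_simps)
  have ev: "eventually P F \<longleftrightarrow> (\<exists>\<delta>>0. \<forall>y s. 0 < s \<and> s < t \<and> dist (y, s) (x, t) < \<delta> \<longrightarrow> P (y, s))"
    for P
    unfolding F_def eventually_at using t by (auto simp: space_time_def)
  have le: "u (x, t) - u (y, s) \<le> (t - s) * (L x t (dist x y / (t - s)) + \<epsilon>) \<longleftrightarrow> g y s \<le> \<epsilon>"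
    if "s < t" for y s \<epsilon>
    using that by (simp add: g_def pos_divide_le_eq algebra_simps)
  have ge: "u (x, t) - u (y, s) \<ge> (t - s) * (L x t (dist x y / (t - s)) - \<epsilon>) \<longleftrightarrow> g y s \<ge> - \<epsilon>"
    if "s < t" for y s \<epsilon>
    using that by (simp add: g_def pos_le_divide_eq algebra_simps) (simp add: field_simps)
  have sub: "Limsup F X \<le> ereal k \<longleftrightarrow> ?sub"
  proof
    assume *: "Limsup F X \<le> ereal k"
    show ?sub
    proof (intro allI impI)
      fix \<epsilon> :: real assume "\<epsilon> > 0"
      then have "ereal k < ereal (k + \<epsilon>)" by simp
      with * have "eventually (\<lambda>z. X z < ereal (k + \<epsilon>)) F"
        unfolding Limsup_le_iff by blast
      then obtain \<delta> where "\<delta> > 0"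
        "\<forall>y s. 0 < s \<and> s < t \<and> dist (y, s) (x, t) < \<delta> \<longrightarrow> X (y, s) < ereal (k + \<epsilon>)"
        unfolding ev by blast
      then show "\<exists>\<delta>>0. \<forall>y s. 0 < s \<and> s < t \<and> dist (y, s) (x, t) < \<delta> \<longrightarrow>
        u (x, t) - u (y, s) \<le> (t - s) * (L x t (dist x y / (t - s)) + \<epsilon>)"
        using le X by (intro exI[of _ \<delta>]) (force simp: less_imp_le)
    qed
  next
    assume *: ?sub
    show "Limsup F X \<le> ereal k"
      unfolding Limsup_le_iff
    proof (intro allI impI)
      fix b assume "ereal k < b"
      then obtain c where c: "k < c" "ereal c < b"
        using ereal_dense2 less_ereal.simps(1) by metis
      then have "c - k > 0" by simp
      with * obtain \<delta> where \<delta>: "\<delta> > 0" "\<And>y s. 0 < s \<and> s < t \<and> dist (y, s) (x, t) < \<delta> \<Longrightarrow>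
        u (x, t) - u (y, s) \<le> (t - s) * (L x t (dist x y / (t - s)) + (c - k))" by blast
      have "X (y, s) < b" if "0 < s \<and> s < t \<and> dist (y, s) (x, t) < \<delta>" for y s
      proof -
        have "g y s \<le> c - k" using \<delta>(2)[OF that] le that by blast
        then have "X (y, s) \<le> ereal c" using X that by simp
        then show ?thesis using c(2) by order
      qed
      then show "eventually (\<lambda>z. X z < b) F" unfolding ev using \<delta>(1) by blast
    qed
  qed
  have super: "ereal k \<le> Limsup F X \<longleftrightarrow> ?super"
  proof
    assume *: "ereal k \<le> Limsup F X"
    show ?super
    proof (intro allI impI, rule ccontr)
      fix \<epsilon> \<delta> :: real assume e: "\<epsilon> > 0" "\<delta> > 0"
      assume "\<nexists>y s. 0 < s \<and> s < t \<and> dist (y, s) (x, t) < \<delta> \<and>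
        u (x, t) - u (y, s) \<ge> (t - s) * (L x t (dist x y / (t - s)) - \<epsilon>)"
      then have "\<forall>y s. 0 < s \<and> s < t \<and> dist (y, s) (x, t) < \<delta> \<longrightarrow> X (y, s) \<le> ereal (k - \<epsilon>)"
        using ge X by force
      then have "eventually (\<lambda>z. X z \<le> ereal (k - \<epsilon>)) F" unfolding ev using e(2) by blast
      then have "Limsup F X \<le> ereal (k - \<epsilon>)" by (rule Limsup_bounded)
      then have "ereal k \<le> ereal (k - \<epsilon>)" using * by order
      then show False using e(1) by simp
    qed
  next
    assume *: ?super
    show "ereal k \<le> Limsup F X"
    proof (rule ccontr)
      assume "\<not> ereal k \<le> Limsup F X"
      then obtain c where c: "c < k" "Limsup F X < ereal c"
        using ereal_dense2 less_ereal.simps(1) by (metis linorder_not_le)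
      have "eventually (\<lambda>z. X z < ereal c) F" using c(2) Limsup_lessD by blast
      then obtain \<delta> where \<delta>: "\<delta> > 0"
        "\<And>y s. 0 < s \<and> s < t \<and> dist (y, s) (x, t) < \<delta> \<Longrightarrow> X (y, s) < ereal c"
        unfolding ev by blast
      have "k - c > 0" using c by simp
      then obtain y s where ys: "0 < s" "s < t" "dist (y, s) (x, t) < \<delta>"
        "u (x, t) - u (y, s) \<ge> (t - s) * (L x t (dist x y / (t - s)) - (k - c))"
        using * \<delta>(1) by blast
      then have "g y s \<ge> - (k - c)" using ge by blast
      moreover have "g y s + k < c" using \<delta>(2)[of s y] ys X by simp
      ultimately show False by simp
    qed
  qed
  show ?thesis unfolding slope sub[symmetric] super[symmetric] by (auto simp: order_eq_iff)
qed

section \<open>Superlinearity and the Lagrangian\<close>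

text \<open>Used twice: to choose the maximal speed \<open>Q\<close> of the Perron construction, and to bound the speed of
  the backward steps in the comparison argument. The \<open>1\<close> absorbs an error \<open>\<epsilon> \<le> 1\<close> there.\<close>

lemma superlinear_exceeds_affine:
  fixes m :: "real \<Rightarrow> real"
  assumes "filterlim (\<lambda>q. m q / q) at_top at_top" and K: "K \<ge> 0"
  shows "\<exists>Q\<ge>2. \<forall>q\<ge>Q. m q > K * (q + 1) + 1"
proof -
  have "eventually (\<lambda>q. m q / q > 2 * K + 2) at_top"
    using assms(1) by (simp add: filterlim_at_top_dense)
  then obtain N where N: "\<And>q. q \<ge> N \<Longrightarrow> m q / q > 2 * K + 2"
    by (auto simp: eventually_at_top_linorder)
  have "m q > K * (q + 1) + 1" if q: "q \<ge> max N 2" for q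
  proof -
    have "m q > (2 * K + 2) * q" using N[of q] q by (simp add: pos_less_divide_eq)
    moreover have "K * 1 \<le> K * q" using K q by (intro mult_left_mono) auto
    ultimately show ?thesis using q by (simp add: algebra_simps)
  qed
  then show ?thesis by (intro exI[of _ "max N 2"]) auto
qed

lemma superlinear_above_affine:
  fixes m :: "real \<Rightarrow> real"
  assumes sup: "filterlim (\<lambda>q. m q / q) at_top at_top" and cont: "continuous_on UNIV m" and K: "K \<ge> 0"
  shows "\<exists>C\<ge>0. \<forall>q\<ge>0. m q \<ge> K * q - C"
proof -
  obtain Q where Q: "Q \<ge> 2" "\<And>q. q \<ge> Q \<Longrightarrow> m q > K * (q + 1) + 1"
    using superlinear_exceeds_affine[OF sup K] by blast
  have "compact ((\<lambda>q. m q - K * q) ` {0..Q})"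
    using cont by (intro compact_continuous_image continuous_intros)
      (auto intro: continuous_on_subset)
  then obtain c where "\<forall>q\<in>{0..Q}. \<bar>m q - K * q\<bar> \<le> c"
    by (auto dest!: compact_imp_bounded simp: bounded_iff)
  then have c: "\<And>q. 0 \<le> q \<Longrightarrow> q \<le> Q \<Longrightarrow> \<bar>m q - K * q\<bar> \<le> c" by auto
  have "m q \<ge> K * q - max c 0" if "q \<ge> 0" for q
  proof (cases "q \<le> Q")
    case True
    then show ?thesis using c[OF that] by linarith
  next
    case False
    then show ?thesis using Q(2)[of q] K by (simp add: algebra_simps)
  qed
  then show ?thesis by (intro exI[of _ "max c 0"]) auto
qed

lemma cond_H1_superlinear:
  assumes "cond_H1 T H"
  shows "\<exists>R\<ge>1. \<forall>x. \<forall>t\<in>{0<..<T}. \<forall>p\<ge>R. K * p \<le> H x t p"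
proof -
  have "eventually (\<lambda>R. ereal K < (INF (x, t, p) \<in> UNIV \<times> {0<..<T} \<times> {R..}. ereal (H x t p / p))) at_top"
    using assms unfolding cond_H1_def by (intro order_tendstoD(1)[of _ \<infinity>]) auto
  then obtain N where "\<And>R. R \<ge> N \<Longrightarrow>
      ereal K < (INF (x, t, p) \<in> UNIV \<times> {0<..<T} \<times> {R..}. ereal (H x t p / p))"
    by (auto simp: eventually_at_top_linorder)
  then have *: "ereal K < (INF (x, t, p) \<in> UNIV \<times> {0<..<T} \<times> {max N 1..}. ereal (H x t p / p))"
    by simp
  have "K * p \<le> H x t p" if "t \<in> {0<..<T}" "p \<ge> max N 1" for x t p
  proof -
    have "(INF (x, t, p) \<in> UNIV \<times> {0<..<T} \<times> {max N 1..}. ereal (H x t p / p)) \<le> ereal (H x t p / p)"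
      by (rule INF_lower2[of "(x, t, p)"]) (use that in auto)
    with * have "ereal K < ereal (H x t p / p)" by order
    then show ?thesis using that(2) by (simp add: pos_less_divide_eq)
  qed
  then show ?thesis by (intro exI[of _ "max N 1"]) auto
qed

text \<open>For slopes \<open>p \<ge> R\<close> the term \<open>p q - H\<close> is nonpositive by superlinearity; for \<open>p \<le> R\<close> the
  monotonicity of \<open>H\<close> replaces \<open>H x t p\<close> by \<open>H x t 0\<close>. Thus the supremum defining the Lagrangian is
  finite, and it is controlled by \<open>- H x t 0\<close>, which is a lower bound for the Lagrangian at speed \<open>0\<close>.\<close>

lemma Legendre_terms_bounded:
  assumes H1: "cond_H1 T H" and q: "q \<ge> 0"
  shows "\<exists>R\<ge>1. \<forall>x. \<forall>t\<in>{0<..<T}. \<forall>p\<ge>0. p * q - H x t p \<le> max 0 (R * q - H x t 0)"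
proof -
  obtain R where R: "R \<ge> 1" "\<And>x t p. t \<in> {0<..<T} \<Longrightarrow> p \<ge> R \<Longrightarrow> q * p \<le> H x t p"
    using cond_H1_superlinear[OF H1, of q] by blast
  have "p * q - H x t p \<le> max 0 (R * q - H x t 0)" if t: "t \<in> {0<..<T}" and p: "p \<ge> 0" for x t p
  proof (cases "p \<ge> R")
    case True
    then show ?thesis using R(2)[OF t True, of x] by (simp add: mult.commute le_max_iff_disj)
  next
    case False
    have "H x t 0 \<le> H x t p"
      using H1 t p unfolding cond_H1_def by (meson atLeast_iff mono_onD order_refl)
    moreover have "p * q \<le> R * q" using False q by (intro mult_right_mono) auto
    ultimately show ?thesis by linarith
  qed
  then show ?thesis using R(1) by blast
qed

lemma Lagrangian_ge:
  assumes "cond_H1 T H" "t \<in> {0<..<T}" "q \<ge> 0" "p \<ge> 0"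
  shows "p * q - H x t p \<le> Lagrangian H x t q"
proof -
  have "bdd_above ((\<lambda>p. p * q - H x t p) ` {0..})"
    using Legendre_terms_bounded[OF assms(1,3)] assms(2) unfolding bdd_above_def by fastforce
  then show ?thesis unfolding Lagrangian_def using assms(4) by (intro cSUP_upper) auto
qed

lemma Lagrangian_le:
  assumes "\<And>p. p \<ge> 0 \<Longrightarrow> p * q - H x t p \<le> c"
  shows "Lagrangian H x t q \<le> c"
  unfolding Lagrangian_def using assms by (intro cSUP_least) auto

lemma Lagrangian_mono:
  assumes "cond_H1 T H" "t \<in> {0<..<T}"
  shows "mono_on {0..} (Lagrangian H x t)"
proof (rule mono_onI)
  fix a b :: real assume ab: "a \<in> {0..}" "b \<in> {0..}" "a \<le> b"
  have "p * a - H x t p \<le> Lagrangian H x t b" if "p \<ge> 0" for p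
    using Lagrangian_ge[OF assms, of b p x] ab that mult_left_mono[OF ab(3) that] by auto
  then show "Lagrangian H x t a \<le> Lagrangian H x t b" by (rule Lagrangian_le)
qed

lemma Lagrangian_convex:
  assumes "cond_H1 T H" "t \<in> {0<..<T}"
  shows "convex_on {0..} (Lagrangian H x t)"
proof (rule convex_onI)
  fix s a b :: real assume s: "0 < s" "s < 1" and ab: "a \<in> {0..}" "b \<in> {0..}"
  show "Lagrangian H x t ((1 - s) *\<^sub>R a + s *\<^sub>R b)
      \<le> (1 - s) * Lagrangian H x t a + s * Lagrangian H x t b"
  proof (rule Lagrangian_le)
    fix p :: real assume p: "p \<ge> 0"
    have "(1 - s) * (p * a - H x t p) \<le> (1 - s) * Lagrangian H x t a"
      "s * (p * b - H x t p) \<le> s * Lagrangian H x t b"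
      using Lagrangian_ge[OF assms _ p] s ab by (auto intro!: mult_left_mono)
    then show "p * ((1 - s) *\<^sub>R a + s *\<^sub>R b) - H x t p
      \<le> (1 - s) * Lagrangian H x t a + s * Lagrangian H x t b"
      by (simp add: algebra_simps)
  qed
qed simp

text \<open>The bound at speed \<open>0\<close> propagates to a bound at every speed that is uniform in space and time.
  It is what makes moving at a fixed speed an affordable competitor at every point.\<close>

lemma Lagrangian_bounded_above:
  assumes H1: "cond_H1 T H" and H3: "cond_H3 T (Lagrangian H)" and q: "q \<ge> 0"
  shows "\<exists>B\<ge>0. \<forall>x. \<forall>t\<in>{0<..<T}. Lagrangian H x t q \<le> B"
proof -
  obtain c where c: "(SUP (x, t) \<in> UNIV \<times> {0<..<T}. ereal (Lagrangian H x t 0)) < ereal c"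
    using H3 ereal_dense2 unfolding cond_H3_def by blast
  obtain R where R: "R \<ge> 1"
    "\<And>x t p. t \<in> {0<..<T} \<Longrightarrow> p \<ge> 0 \<Longrightarrow> p * q - H x t p \<le> max 0 (R * q - H x t 0)"
    using Legendre_terms_bounded[OF H1 q] by blast
  have "Lagrangian H x t q \<le> max 0 (R * q + c)" if t: "t \<in> {0<..<T}" for x t
  proof (rule Lagrangian_le)
    fix p :: real assume p: "p \<ge> 0"
    have "ereal (Lagrangian H x t 0) \<le> (SUP (x, t) \<in> UNIV \<times> {0<..<T}. ereal (Lagrangian H x t 0))"
      by (rule SUP_upper2[of "(x, t)"]) (use t in auto)
    with c have "ereal (Lagrangian H x t 0) < ereal c" by order
    then have "- H x t 0 \<le> c" using Lagrangian_ge[OF H1 t, of 0 0 x] by simp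
    then show "p * q - H x t p \<le> max 0 (R * q + c)" using R(2)[OF t p, of x] by linarith
  qed
  then show ?thesis by (intro exI[of _ "max 0 (R * q + c)"]) auto
qed

text \<open>For bounded speeds the weight \<open>1 + \<bar>m q\<bar>\<close> is bounded, so the oscillation of the Lagrangian in
  \<open>(x, t)\<close> is uniformly small over the whole, possibly unbounded, space.\<close>

lemma cond_H4_locally_uniform:
  assumes H4: "cond_H4 T L m" and m: "continuous_on UNIV m" and e: "\<epsilon> > 0"
  shows "\<exists>\<delta>>0. \<forall>x y. \<forall>t\<in>{0<..<T}. \<forall>s\<in>{0<..<T}. \<forall>q\<in>{0..Q}.
           dist x y + \<bar>t - s\<bar> < \<delta> \<longrightarrow> \<bar>L x t q - L y s q\<bar> \<le> \<epsilon>"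
proof -
  obtain \<omega> where \<omega>: "modulus_of_continuity \<omega>" and osc:
    "\<And>x y t s q. t \<in> {0<..<T} \<Longrightarrow> s \<in> {0<..<T} \<Longrightarrow> q \<ge> 0 \<Longrightarrow>
        \<bar>L x t q - L y s q\<bar> \<le> \<omega> (dist x y + \<bar>t - s\<bar>) * (1 + \<bar>m q\<bar>)"
    using H4 unfolding cond_H4_def by blast
  have "compact (m ` {0..Q})"
    using m by (intro compact_continuous_image) (auto intro: continuous_on_subset)
  then obtain M where M: "\<forall>q\<in>{0..Q}. \<bar>m q\<bar> \<le> M"
    by (auto dest!: compact_imp_bounded simp: bounded_iff)
  define N where "N = 1 + max M 0"
  have N: "N > 0" "\<And>q. q \<in> {0..Q} \<Longrightarrow> 1 + \<bar>m q\<bar> \<le> N" using M by (force simp: N_def)+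
  have "\<omega> 0 = 0" "continuous_on {0..} \<omega>" using \<omega> by (auto simp: modulus_of_continuity_def)
  then obtain \<delta> where \<delta>: "\<delta> > 0" "\<And>h. h \<ge> 0 \<Longrightarrow> h < \<delta> \<Longrightarrow> \<bar>\<omega> h\<bar> < \<epsilon> / N"
    using e N(1) unfolding continuous_on_iff
    by (metis abs_of_nonneg atLeast_iff diff_zero dist_real_def divide_pos_pos order_refl)
  have "\<bar>L x t q - L y s q\<bar> \<le> \<epsilon>"
    if "t \<in> {0<..<T}" "s \<in> {0<..<T}" "q \<in> {0..Q}" "dist x y + \<bar>t - s\<bar> < \<delta>" for x y t s q
  proof -
    have "\<bar>L x t q - L y s q\<bar> \<le> \<omega> (dist x y + \<bar>t - s\<bar>) * (1 + \<bar>m q\<bar>)"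
      using osc that by simp
    also have "\<dots> \<le> \<epsilon> / N * N"
      using \<delta>(2)[of "dist x y + \<bar>t - s\<bar>"] that N e by (intro mult_mono) auto
    finally show ?thesis using N by simp
  qed
  then show ?thesis using \<delta>(1) by blast
qed

section \<open>The Perron supremum of dominated functions\<close>

text \<open>\<open>B\<^sub>2\<close> bounds the cost of motion at speed \<open>2\<close>, \<open>C\<^sub>T\<close> is the Lipschitz constant of the Lagrangian in
  time, \<open>\<Lambda>\<close> that of the initial datum, and \<open>C\<^sub>0\<close> is the constant for which \<open>\<Lambda> q - C\<^sub>0\<close> lies below the
  Lagrangian. Competing motions have speed at most \<open>Q\<close>; the requirement \<open>Q \<ge> 2\<close> leaves room
  for steps of length \<open>d\<close> within time \<open>d\<close>, whose speed must exceed \<open>1\<close> strictly.\<close>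

locale perron_problem =
  fixes L :: "'a::metric_space \<Rightarrow> real \<Rightarrow> real \<Rightarrow> real" and T :: real and m :: "real \<Rightarrow> real"
    and C\<^sub>T B\<^sub>2 :: real and u0 :: "'a \<Rightarrow> real" and \<Lambda> C\<^sub>0 Q :: real
  assumes T: "T > 0"
    and split: "\<And>(y::'a) x q a b. dist y x < q * (a + b) \<Longrightarrow> a > 0 \<Longrightarrow> b > 0 \<Longrightarrow>
                  \<exists>z. dist y z < q * a \<and> dist z x < q * b"
    and convex: "\<And>x t. 0 < t \<Longrightarrow> t < T \<Longrightarrow> convex_on {0..} (L x t)"
    and mono: "\<And>x t. 0 < t \<Longrightarrow> t < T \<Longrightarrow> mono_on {0..} (L x t)"
    and continuous: "\<And>x t. 0 < t \<Longrightarrow> t < T \<Longrightarrow> continuous_on {0..} (L x t)"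
    and lower: "\<And>x t q. 0 < t \<Longrightarrow> t < T \<Longrightarrow> q \<ge> 0 \<Longrightarrow> m q \<le> L x t q"
    and upper: "\<And>x t. 0 < t \<Longrightarrow> t < T \<Longrightarrow> L x t 2 \<le> B\<^sub>2"
    and B\<^sub>2: "B\<^sub>2 \<ge> 0"
    and oscillation: "\<And>\<epsilon>. \<epsilon> > 0 \<Longrightarrow> \<exists>\<delta>>0. \<forall>x y. \<forall>t\<in>{0<..<T}. \<forall>s\<in>{0<..<T}. \<forall>q\<in>{0..Q}.
           dist x y + \<bar>t - s\<bar> < \<delta> \<longrightarrow> \<bar>L x t q - L y s q\<bar> \<le> \<epsilon>"
    and time_Lipschitz: "\<And>x t s q. 0 < t \<Longrightarrow> t < T \<Longrightarrow> 0 < s \<Longrightarrow> s < T \<Longrightarrow> q \<ge> 0 \<Longrightarrow>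
           \<bar>L x t q - L x s q\<bar> \<le> C\<^sub>T * \<bar>t - s\<bar>"
    and C\<^sub>T: "C\<^sub>T \<ge> 0"
    and datum_Lipschitz: "\<And>x y. \<bar>u0 x - u0 y\<bar> \<le> \<Lambda> * dist x y"
    and \<Lambda>: "\<Lambda> \<ge> 0"
    and slope_below: "\<And>q. q \<ge> 0 \<Longrightarrow> \<Lambda> * q - C\<^sub>0 \<le> m q"
    and C\<^sub>0: "C\<^sub>0 \<ge> 0"
    and Q: "Q \<ge> 2"
begin

text \<open>The diamond consists of the points that a motion of speed at most \<open>q\<close> from \<open>(y, s)\<close> to \<open>(x, t)\<close> can
  visit. Working with its upper bounds \<open>c\<close> makes the cost of a step monotone under subdivision
  for trivial reasons: a piece of the motion has a smaller diamond. The initial time \<open>s\<close> is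
  left out because \<open>L\<close> is meaningless at \<open>s = 0\<close>.\<close>

definition diamond_bound :: "'a \<Rightarrow> real \<Rightarrow> 'a \<Rightarrow> real \<Rightarrow> real \<Rightarrow> real \<Rightarrow> bool" where
  "diamond_bound y s x t q c \<longleftrightarrow>
     (\<forall>z r. s < r \<and> r \<le> t \<and> dist y z \<le> q * (r - s) \<and> dist z x \<le> q * (t - r) \<longrightarrow> L z r q \<le> c)"

definition dominated :: "('a \<times> real) set \<Rightarrow> ('a \<times> real \<Rightarrow> real) \<Rightarrow> bool" where
  "dominated D f \<longleftrightarrow>
     (\<forall>y s x t q c. (y, s) \<in> D \<and> (x, t) \<in> D \<and> s < t \<and> 0 < q \<and> q \<le> Q \<and> dist y x < q * (t - s) \<and>
        diamond_bound y s x t q c \<longrightarrow> f (x, t) \<le> f (y, s) + (t - s) * c)"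

definition strip :: "('a \<times> real) set" where
  "strip = UNIV \<times> {0..<T}"

lemma in_strip [simp]: "(x, t) \<in> strip \<longleftrightarrow> 0 \<le> t \<and> t < T"
  by (simp add: strip_def)

definition admissible :: "('a \<times> real \<Rightarrow> real) \<Rightarrow> bool" where
  "admissible f \<longleftrightarrow> dominated strip f \<and> (\<forall>x. f (x, 0) \<le> u0 x)"

definition perron :: "'a \<times> real \<Rightarrow> real" where
  "perron z = (SUP f\<in>Collect admissible. f z)"

lemma dominatedD:
  assumes "dominated D f" "(y, s) \<in> D" "(x, t) \<in> D" "s < t" "0 < q" "q \<le> Q"
    "dist y x < q * (t - s)" "diamond_bound y s x t q c"
  shows "f (x, t) \<le> f (y, s) + (t - s) * c"
  using assms unfolding dominated_def by blast

lemma diamond_bound_end: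
  assumes "diamond_bound y s x t q c" "s < t" "dist y x < q * (t - s)"
  shows "L x t q \<le> c"
  using assms unfolding diamond_bound_def by (elim allE[of _ x] allE[of _ t]) auto

lemma diamond_bound_left:
  assumes "diamond_bound y s x t q c" "r \<le> t" "dist z x \<le> q * (t - r)"
  shows "diamond_bound y s z r q c"
  unfolding diamond_bound_def
proof (intro allI impI)
  fix z' r' assume *: "s < r' \<and> r' \<le> r \<and> dist y z' \<le> q * (r' - s) \<and> dist z' z \<le> q * (r - r')"
  then have "dist z' x \<le> q * (t - r')"
    using assms(3) dist_triangle[of z' x z] by (simp add: algebra_simps)
  then show "L z' r' q \<le> c" using assms * unfolding diamond_bound_def by auto
qed

lemma diamond_bound_right:
  assumes "diamond_bound y s x t q c" "s \<le> r" "dist y z \<le> q * (r - s)"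
  shows "diamond_bound z r x t q c"
  unfolding diamond_bound_def
proof (intro allI impI)
  fix z' r' assume *: "r < r' \<and> r' \<le> t \<and> dist z z' \<le> q * (r' - r) \<and> dist z' x \<le> q * (t - r')"
  then have "dist y z' \<le> q * (r' - s)"
    using assms(3) dist_triangle[of y z' z] by (simp add: algebra_simps)
  then show "L z' r' q \<le> c" using assms * unfolding diamond_bound_def by auto
qed

text \<open>The only new case is a step from a point before time \<open>r\<close> to a point of \<open>D\<close> after it. It is cut at
  time \<open>r\<close>: \<open>g\<close> obeys the second piece, \<open>f\<close> the first, and \<open>g \<le> f\<close> at the cut. Both pieces have their
  diamonds inside the original one, so the same \<open>c\<close> serves.\<close>

lemma paste_dominated:
  assumes f: "dominated strip f" and g: "dominated D g"
    and D: "D \<subseteq> UNIV \<times> {r..<T}" and r: "0 \<le> r"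
    and past: "\<And>x t y s. (x, t) \<in> D \<Longrightarrow> r \<le> s \<Longrightarrow> s < t \<Longrightarrow> dist y x < Q * (t - s) \<Longrightarrow> (y, s) \<in> D"
    and gf: "\<And>x. (x, r) \<in> D \<Longrightarrow> g (x, r) \<le> f (x, r)"
  shows "dominated strip (\<lambda>z. if z \<in> D then max (f z) (g z) else f z)" (is "dominated strip ?h")
  unfolding dominated_def
proof (intro allI impI, elim conjE)
  fix y s x t q c
  assume 1: "(y, s) \<in> strip" "(x, t) \<in> strip" "s < t" "0 < q" "q \<le> Q" "dist y x < q * (t - s)"
    and c: "diamond_bound y s x t q c"
  have "f (x, t) \<le> f (y, s) + (t - s) * c" using dominatedD[OF f 1 c] .
  also have "f (y, s) \<le> ?h (y, s)" by simp
  finally have fle: "f (x, t) \<le> ?h (y, s) + (t - s) * c" by simp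
  have "g (x, t) \<le> ?h (y, s) + (t - s) * c" if xt: "(x, t) \<in> D"
  proof -
    have rt: "r \<le> t" using xt D by auto
    have speed: "dist a b < Q * h" if "dist a b < q * h" "h \<ge> 0" for a b :: 'a and h
      using that(1) mult_right_mono[OF 1(5) that(2)] by linarith
    consider "r \<le> s" | "s < r" "r = t" | "s < r" "r < t" using rt by linarith
    then show ?thesis
    proof cases
      case 1
      then have "(y, s) \<in> D" using past[OF xt 1 \<open>s < t\<close>] speed \<open>dist y x < q * (t - s)\<close> \<open>s < t\<close> by simp
      moreover from this have "g (x, t) \<le> g (y, s) + (t - s) * c"
        using dominatedD[OF g _ xt \<open>s < t\<close> \<open>0 < q\<close> \<open>q \<le> Q\<close> \<open>dist y x < q * (t - s)\<close> c] by simp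
      ultimately show ?thesis by simp
    next
      case 2
      then show ?thesis using gf[of x] xt fle by simp
    next
      case 3
      have "\<exists>z. dist y z < q * (r - s) \<and> dist z x < q * (t - r)"
        by (rule split) (use 3 \<open>dist y x < q * (t - s)\<close> in auto)
      then obtain z where z: "dist y z < q * (r - s)" "dist z x < q * (t - r)" by blast
      have zD: "(z, r) \<in> D" using past[OF xt _ 3(2), of z] speed[OF z(2)] 3 by simp
      have "g (x, t) \<le> g (z, r) + (t - r) * c"
        using dominatedD[OF g zD xt 3(2) \<open>0 < q\<close> \<open>q \<le> Q\<close> z(2)]
          diamond_bound_right[OF c _ less_imp_le[OF z(1)]] 3 by simp
      also have "g (z, r) \<le> f (z, r)" using gf zD .
      also have "f (z, r) \<le> f (y, s) + (r - s) * c"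
        using dominatedD[OF f _ _ 3(1) \<open>0 < q\<close> \<open>q \<le> Q\<close> z(1)]
          diamond_bound_left[OF c _ less_imp_le[OF z(2)]] 3 1(1,2) by simp
      also have "f (y, s) \<le> ?h (y, s)" by simp
      finally show ?thesis by (simp add: algebra_simps)
    qed
  qed
  with fle show "?h (x, t) \<le> ?h (y, s) + (t - s) * c" by simp
qed

lemma admissible_upper:
  assumes f: "admissible f" and t: "0 \<le> t" "t < T"
  shows "f (x, t) \<le> u0 x + B\<^sub>2 * t"
proof (cases "t = 0")
  case True
  then show ?thesis using f by (simp add: admissible_def)
next
  case False
  have "f (x, t) \<le> f (x, 0) + (t - 0) * B\<^sub>2"
    by (rule dominatedD[of strip f _ _ _ _ 2])
      (use f t T Q upper False in \<open>auto simp: admissible_def diamond_bound_def\<close>)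
  also have "f (x, 0) \<le> u0 x" using f by (simp add: admissible_def)
  finally show ?thesis by (simp add: mult.commute)
qed

text \<open>A step of speed \<open>q\<close> changes \<open>u0\<close> by at most \<open>\<Lambda> q\<close> per unit of time but costs at least \<open>\<Lambda> q - C\<^sub>0\<close>.\<close>

lemma admissible_lower_barrier: "admissible (\<lambda>(x, t). u0 x - C\<^sub>0 * t)"
  unfolding admissible_def dominated_def
proof (intro conjI allI impI, elim conjE)
  fix y s x t q c
  assume 1: "(y, s) \<in> strip" "(x, t) \<in> strip" "s < t" "0 < q" "q \<le> Q" "dist y x < q * (t - s)"
    and c: "diamond_bound y s x t q c"
  have "\<Lambda> * q - C\<^sub>0 \<le> c"
    using slope_below[of q] lower[of t q x] diamond_bound_end[OF c 1(3,6)] 1 by simp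
  then have "(t - s) * (\<Lambda> * q - C\<^sub>0) \<le> (t - s) * c" using 1 by (intro mult_left_mono) auto
  moreover have "u0 x - u0 y \<le> \<Lambda> * (q * (t - s))"
    using datum_Lipschitz[of x y] mult_left_mono[OF less_imp_le[OF 1(6)] \<Lambda>]
    by (simp add: dist_commute)
  ultimately show "(case (x, t) of (x, t) \<Rightarrow> u0 x - C\<^sub>0 * t)
      \<le> (case (y, s) of (x, t) \<Rightarrow> u0 x - C\<^sub>0 * t) + (t - s) * c"
    by (simp add: algebra_simps)
qed auto

lemma bdd_above_admissible:
  assumes "0 \<le> t" "t < T"
  shows "bdd_above ((\<lambda>f. f (x, t)) ` Collect admissible)"
  using admissible_upper[OF _ assms] by (auto simp: bdd_above_def)

lemma admissible_le_perron: "admissible f \<Longrightarrow> 0 \<le> t \<Longrightarrow> t < T \<Longrightarrow> f (x, t) \<le> perron (x, t)"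
  unfolding perron_def by (intro cSUP_upper bdd_above_admissible) auto

lemma perron_le: "(\<And>f. admissible f \<Longrightarrow> f z \<le> c) \<Longrightarrow> perron z \<le> c"
  unfolding perron_def using admissible_lower_barrier by (intro cSUP_least) auto

lemma admissible_perron: "admissible perron"
  unfolding admissible_def dominated_def
proof (intro conjI allI impI, elim conjE)
  fix y s x t q c
  assume 1: "(y, s) \<in> strip" "(x, t) \<in> strip" "s < t" "0 < q" "q \<le> Q" "dist y x < q * (t - s)"
    "diamond_bound y s x t q c"
  show "perron (x, t) \<le> perron (y, s) + (t - s) * c"
  proof (rule perron_le)
    fix f assume f: "admissible f"
    then have "f (x, t) \<le> f (y, s) + (t - s) * c" using 1 by (intro dominatedD[of strip f]) (auto simp: admissible_def)
    also have "f (y, s) \<le> perron (y, s)" using f 1 by (intro admissible_le_perron) auto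
    finally show "f (x, t) \<le> perron (y, s) + (t - s) * c" by simp
  qed
next
  show "perron (x, 0) \<le> u0 x" for x by (rule perron_le) (simp add: admissible_def)
qed

lemma dominated_perron: "dominated strip perron"
  using admissible_perron by (simp add: admissible_def)

lemma perron_barriers:
  assumes "0 \<le> t" "t < T"
  shows "u0 x - C\<^sub>0 * t \<le> perron (x, t)" "perron (x, t) \<le> u0 x + B\<^sub>2 * t"
  using admissible_le_perron[OF admissible_lower_barrier assms] admissible_upper[OF admissible_perron assms]
  by auto

text \<open>The comparison tool for everything that follows: a competitor on a backward closed set only has to
  be dominated there and to start below the Perron supremum.\<close>

lemma le_perron_if_dominated:
  assumes g: "dominated D g"
    and D: "D \<subseteq> UNIV \<times> {r..<T}" and r: "0 \<le> r"
    and past: "\<And>x t y s. (x, t) \<in> D \<Longrightarrow> r \<le> s \<Longrightarrow> s < t \<Longrightarrow> dist y x < Q * (t - s) \<Longrightarrow> (y, s) \<in> D"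
    and gU: "\<And>x. (x, r) \<in> D \<Longrightarrow> g (x, r) \<le> perron (x, r)"
    and xt: "(x, t) \<in> D"
  shows "g (x, t) \<le> perron (x, t)"
proof -
  let ?h = "\<lambda>z. if z \<in> D then max (perron z) (g z) else perron z"
  have "?h (x, 0) \<le> u0 x" for x
  proof -
    have "g (x, 0) \<le> perron (x, 0)" if "(x, 0) \<in> D"
    proof -
      have "r = 0" using that D r by auto
      then show ?thesis using gU that by simp
    qed
    moreover have "perron (x, 0) \<le> u0 x" using admissible_perron by (simp add: admissible_def)
    ultimately show ?thesis by auto
  qed
  then have "admissible ?h"
    using paste_dominated[OF dominated_perron g D r past gU] by (auto simp: admissible_def)
  then have "?h (x, t) \<le> perron (x, t)" using xt D r by (intro admissible_le_perron) auto
  then show ?thesis using xt by simp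
qed

lemma perron_step:
  assumes "0 \<le> s" "s < t" "t < T" "dist y x < 2 * (t - s)"
  shows "perron (x, t) \<le> perron (y, s) + B\<^sub>2 * (t - s)"
proof -
  have "perron (x, t) \<le> perron (y, s) + (t - s) * B\<^sub>2"
    by (rule dominatedD[OF dominated_perron, where q = 2])
      (use assms Q upper in \<open>auto simp: diamond_bound_def\<close>)
  then show ?thesis by (simp add: mult.commute)
qed

section \<open>Lipschitz regularity of the Perron supremum\<close>

text \<open>The competitor is the supremum itself, started \<open>h\<close> later and lowered by \<open>C\<^sub>0 h\<close>, which is as much as
  the supremum can drop below \<open>u0\<close> until then. Delaying changes the Lagrangian by at most \<open>C\<^sub>T h\<close>,
  which the term \<open>C\<^sub>T h (t - h)\<close> pays for.\<close>

lemma perron_delay: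
  assumes h: "0 \<le> h" and t: "0 \<le> t" "t + h < T"
  shows "perron (x, t) - (C\<^sub>0 + C\<^sub>T * T) * h \<le> perron (x, t + h)"
proof -
  let ?g = "\<lambda>(x, t). perron (x, t - h) - C\<^sub>0 * h - C\<^sub>T * h * (t - h)"
  have "?g (x, t + h) \<le> perron (x, t + h)"
  proof (rule le_perron_if_dominated[where D = "UNIV \<times> {h..<T}" and r = h])
    show "dominated (UNIV \<times> {h..<T}) ?g"
      unfolding dominated_def
    proof (intro allI impI, elim conjE)
      fix y s x t q c
      assume 1: "(y, s) \<in> UNIV \<times> {h..<T}" "(x, t) \<in> UNIV \<times> {h..<T}" "s < t" "0 < q" "q \<le> Q"
        "dist y x < q * (t - s)" and c: "diamond_bound y s x t q c"
      have "diamond_bound y (s - h) x (t - h) q (c + C\<^sub>T * h)"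
        unfolding diamond_bound_def
      proof (intro allI impI, elim conjE)
        fix z r assume z: "s - h < r" "r \<le> t - h" "dist y z \<le> q * (r - (s - h))"
          "dist z x \<le> q * (t - h - r)"
        have "L z r q \<le> L z (r + h) q + C\<^sub>T * h"
          using time_Lipschitz[of "r + h" r q z] z 1 h by simp
        also have "L z (r + h) q \<le> c"
          using c z unfolding diamond_bound_def by (auto simp: algebra_simps)
        finally show "L z r q \<le> c + C\<^sub>T * h" by simp
      qed
      then have "perron (x, t - h) \<le> perron (y, s - h) + (t - h - (s - h)) * (c + C\<^sub>T * h)"
        using 1 h by (intro dominatedD[OF dominated_perron]) auto
      then show "?g (x, t) \<le> ?g (y, s) + (t - s) * c" by (simp add: algebra_simps)
    qed
    show "?g (x, h) \<le> perron (x, h)" for x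
      using perron_barriers(1)[of h x] perron_barriers(2)[of 0 x] h t T by simp
  qed (use h t in auto)
  moreover have "C\<^sub>T * h * t \<le> C\<^sub>T * h * T" using C\<^sub>T h t by (intro mult_left_mono) auto
  ultimately show ?thesis by (simp add: algebra_simps)
qed

text \<open>A Lipschitz constant of the Perron supremum. It must be independent of \<open>Q\<close>, because \<open>Q\<close> is chosen
  in terms of it.\<close>

definition K :: real where
  "K = \<Lambda> + C\<^sub>0 + C\<^sub>T * T + 2 * B\<^sub>2"

lemma K_nonneg: "K \<ge> 0"
  using \<Lambda> C\<^sub>0 C\<^sub>T T B\<^sub>2 by (simp add: K_def)

lemma perron_time:
  assumes "0 \<le> s" "s \<le> t" "t < T"
  shows "\<bar>perron (x, t) - perron (x, s)\<bar> \<le> (C\<^sub>0 + C\<^sub>T * T + B\<^sub>2) * (t - s)"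
proof (cases "s = t")
  case False
  have "perron (x, t) \<le> perron (x, s) + B\<^sub>2 * (t - s)" using perron_step[of s t x x] assms False by simp
  moreover have "perron (x, s) - (C\<^sub>0 + C\<^sub>T * T) * (t - s) \<le> perron (x, t)"
    using perron_delay[of "t - s" s x] assms by simp
  moreover have "0 \<le> B\<^sub>2 * (t - s)" "0 \<le> (C\<^sub>0 + C\<^sub>T * T) * (t - s)"
    using B\<^sub>2 C\<^sub>0 C\<^sub>T T assms by auto
  ultimately show ?thesis by (simp add: distrib_right)
qed simp

text \<open>If enough time has passed, \<open>x\<close> is reached from \<open>y\<close> at speed \<open>2\<close> in the time \<open>d(x, y)\<close>, and regularity in
  time gives back the delay. Otherwise \<open>t \<le> d(x, y)\<close>, and both values are close to \<open>u0\<close>.\<close>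

lemma perron_space:
  assumes t: "0 \<le> t" "t < T"
  shows "perron (x, t) \<le> perron (y, t) + K * dist x y"
proof (cases "dist x y < t")
  case True
  let ?d = "dist x y"
  show ?thesis
  proof (cases "x = y")
    case False
    then have "?d > 0" by simp
    have "perron (x, t) \<le> perron (y, t - ?d) + B\<^sub>2 * ?d"
      using perron_step[of "t - ?d" t y x] True t \<open>?d > 0\<close> by (simp add: dist_commute)
    moreover have "perron (y, t - ?d) \<le> perron (y, t) + (C\<^sub>0 + C\<^sub>T * T + B\<^sub>2) * ?d"
      using perron_time[of "t - ?d" t y] True t by simp
    moreover have "0 \<le> \<Lambda> * ?d" using \<Lambda> by simp
    ultimately show ?thesis by (simp add: K_def algebra_simps)
  qed simp
next
  case False
  let ?d = "dist x y"
  have "perron (x, t) \<le> u0 x + B\<^sub>2 * t" "u0 y \<le> perron (y, t) + C\<^sub>0 * t"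
    using perron_barriers[OF t, of x] perron_barriers[OF t, of y] by simp_all
  moreover have "u0 x \<le> u0 y + \<Lambda> * ?d" using datum_Lipschitz[of x y] by simp
  moreover have "B\<^sub>2 * t \<le> B\<^sub>2 * ?d" "C\<^sub>0 * t \<le> C\<^sub>0 * ?d"
    using False B\<^sub>2 C\<^sub>0 by (auto intro!: mult_left_mono)
  moreover have "0 \<le> C\<^sub>T * T * ?d" "0 \<le> B\<^sub>2 * ?d" using C\<^sub>T B\<^sub>2 T by auto
  ultimately show ?thesis by (simp add: K_def algebra_simps)
qed

lemma U_Lipschitz:
  assumes "0 \<le> s" "s < T" "0 \<le> t" "t < T"
  shows "\<bar>perron (x, t) - perron (y, s)\<bar> \<le> K * (dist x y + \<bar>t - s\<bar>)"
proof -
  have "\<bar>perron (x, t) - perron (x, s)\<bar> \<le> (C\<^sub>0 + C\<^sub>T * T + B\<^sub>2) * \<bar>t - s\<bar>"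
    using perron_time[of s t x] perron_time[of t s x] assms by (cases "s \<le> t") (auto simp: abs_minus_commute)
  also have "\<dots> \<le> K * \<bar>t - s\<bar>" using \<Lambda> B\<^sub>2 by (intro mult_right_mono) (auto simp: K_def)
  finally have "\<bar>perron (x, t) - perron (x, s)\<bar> \<le> K * \<bar>t - s\<bar>" .
  moreover have "\<bar>perron (x, s) - perron (y, s)\<bar> \<le> K * dist x y"
    using perron_space[OF assms(1,2), of x y] perron_space[OF assms(1,2), of y x] by (simp add: dist_commute)
  ultimately show ?thesis by (simp add: distrib_left)
qed

section \<open>The Perron supremum solves the equation\<close>

text \<open>At a speed \<open>q\<^sub>0 < Q\<close> domination applies for all \<open>q\<close> slightly above \<open>q\<^sub>0\<close>, since it requires the
  distance to be strictly below \<open>q (t - s)\<close>; continuity of \<open>L\<close> in the speed then gives \<open>q\<^sub>0\<close> itself.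
  For speeds \<open>q \<ge> Q\<close> the Lipschitz bound \<open>K (q + 1) (t - s)\<close> does not exceed the cost.\<close>

lemma perron_subsolution:
  assumes t: "0 < t" "t < T" and e: "\<epsilon> > 0" and large: "\<And>q. q \<ge> Q \<Longrightarrow> K * (q + 1) \<le> m q"
  shows "\<exists>\<delta>>0. \<forall>y s. 0 < s \<and> s < t \<and> dist (y, s) (x, t) < \<delta> \<longrightarrow>
        perron (x, t) - perron (y, s) \<le> (t - s) * (L x t (dist x y / (t - s)) + \<epsilon>)"
proof -
  obtain \<delta> where \<delta>: "\<delta> > 0" "\<And>x y t s q. t \<in> {0<..<T} \<Longrightarrow> s \<in> {0<..<T} \<Longrightarrow> q \<in> {0..Q} \<Longrightarrow>
     dist x y + \<bar>t - s\<bar> < \<delta> \<Longrightarrow> \<bar>L x t q - L y s q\<bar> \<le> \<epsilon>"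
    using oscillation[OF e] by blast
  have "perron (x, t) - perron (y, s) \<le> (t - s) * (L x t (dist x y / (t - s)) + \<epsilon>)"
    if s: "0 < s" "s < t" and near: "dist (y, s) (x, t) < \<delta> / (Q + 1)" for y s
  proof -
    define h where "h = t - s"
    define q\<^sub>0 where "q\<^sub>0 = dist x y / h"
    have h: "h > 0" using s by (simp add: h_def)
    have "h \<le> dist (y, s) (x, t)" using dist_snd_le[of "(y, s)" "(x, t)"] h by (simp add: h_def dist_real_def)
    then have "h < \<delta> / (Q + 1)" using near by simp
    then have h\<delta>: "(Q + 1) * h < \<delta>" using Q by (simp add: pos_less_divide_eq mult.commute)
    have q\<^sub>0: "q\<^sub>0 \<ge> 0" "dist x y = q\<^sub>0 * h" using h by (auto simp: q\<^sub>0_def)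
    show ?thesis
    proof (cases "q\<^sub>0 < Q")
      case False
      have "perron (x, t) - perron (y, s) \<le> K * (dist x y + h)"
        using U_Lipschitz[of s t x y] s t by (simp add: h_def)
      also have "\<dots> = h * (K * (q\<^sub>0 + 1))" by (simp add: q\<^sub>0(2) algebra_simps)
      also have "K * (q\<^sub>0 + 1) \<le> L x t q\<^sub>0 + \<epsilon>"
        using large[of q\<^sub>0] lower[OF t q\<^sub>0(1), of x] False e by simp
      finally show ?thesis using h by (simp add: h_def q\<^sub>0_def)
    next
      case True
      have faster: "perron (x, t) - perron (y, s) \<le> h * (L x t q + \<epsilon>)" if q: "q\<^sub>0 < q" "q < Q" for q
      proof -
        have "diamond_bound y s x t q (L x t q + \<epsilon>)"
          unfolding diamond_bound_def
        proof (intro allI impI, elim conjE)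
          fix z r assume z: "s < r" "r \<le> t" "dist z x \<le> q * (t - r)"
          \<comment> \<open>The diamond lies within \<open>(Q + 1) h\<close> of its end point, hence the radius
            \<open>\<delta> / (Q + 1)\<close> above.\<close>
          have "dist z x + \<bar>r - t\<bar> \<le> (q + 1) * (t - r)" using z by (simp add: algebra_simps)
          also have "\<dots> \<le> (Q + 1) * h" using z q q\<^sub>0 by (intro mult_mono) (auto simp: h_def)
          finally have "\<bar>L z r q - L x t q\<bar> \<le> \<epsilon>" using \<delta>(2)[of r t q z x] z q q\<^sub>0 s t h\<delta> by simp
          then show "L z r q \<le> L x t q + \<epsilon>" by simp
        qed
        moreover have "dist y x < q * (t - s)"
          using q\<^sub>0 q h mult_strict_right_mono[OF q(1) h] by (simp add: h_def dist_commute)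
        ultimately have "perron (x, t) \<le> perron (y, s) + (t - s) * (L x t q + \<epsilon>)"
          using s t q q\<^sub>0 by (intro dominatedD[OF dominated_perron]) auto
        then show ?thesis by (simp add: h_def)
      qed
      \<comment> \<open>Domination needs a speed strictly above \<open>q\<^sub>0\<close>, so \<open>q\<^sub>0\<close> itself is reached as a limit.\<close>
      have "continuous (at q\<^sub>0 within {0..}) (L x t)"
        using continuous[OF t, of x] q\<^sub>0 by (simp add: continuous_on_eq_continuous_within)
      then have "(L x t \<longlongrightarrow> L x t q\<^sub>0) (at q\<^sub>0 within {q\<^sub>0<..})"
        unfolding continuous_within by (rule tendsto_within_subset) (use q\<^sub>0 in auto)
      then have "((\<lambda>q. h * (L x t q + \<epsilon>)) \<longlongrightarrow> h * (L x t q\<^sub>0 + \<epsilon>)) (at_right q\<^sub>0)"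
        by (intro tendsto_intros)
      moreover have "eventually (\<lambda>q. perron (x, t) - perron (y, s) \<le> h * (L x t q + \<epsilon>)) (at_right q\<^sub>0)"
        unfolding eventually_at_right[OF True] using faster True by blast
      ultimately have "perron (x, t) - perron (y, s) \<le> h * (L x t q\<^sub>0 + \<epsilon>)"
        by (rule tendsto_lowerbound) simp
      then show ?thesis by (simp add: h_def q\<^sub>0_def)
    qed
  qed
  moreover have "\<delta> / (Q + 1) > 0" using \<delta>(1) Q by simp
  ultimately show ?thesis by blast
qed

text \<open>If \<open>perron (y, s)\<close> were above \<open>perron (x\<^sub>0, t\<^sub>0) - (t\<^sub>0 - s) (\<phi>(d(x\<^sub>0, y) / (t\<^sub>0 - s)) - \<epsilon>)\<close> for all nearby
  earlier points, then \<open>g\<close> could start at time \<open>r\<close> below the supremum, using half of the margin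
  \<open>\<epsilon> h\<close>, and spend the other half on being \<open>h \<epsilon> / 2\<close> above it at \<open>(x\<^sub>0, t\<^sub>0)\<close>. The term \<open>\<epsilon> / 2\<close> in \<open>g\<close>
  compensates for freezing the Lagrangian at \<open>(x\<^sub>0, t\<^sub>0)\<close>. The backward cone \<open>D\<close> of speed \<open>Q\<close> is closed
  under admissible backward steps.\<close>

lemma perron_supersolution:
  assumes t: "0 < t\<^sub>0" "t\<^sub>0 < T" and e: "\<epsilon> > 0" and \<delta>: "\<delta> > 0"
  shows "\<exists>y s. 0 < s \<and> s < t\<^sub>0 \<and> dist (y, s) (x\<^sub>0, t\<^sub>0) < \<delta> \<and>
        perron (x\<^sub>0, t\<^sub>0) - perron (y, s) \<ge> (t\<^sub>0 - s) * (L x\<^sub>0 t\<^sub>0 (dist x\<^sub>0 y / (t\<^sub>0 - s)) - \<epsilon>)"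
proof (rule ccontr)
  define \<phi> where "\<phi> = L x\<^sub>0 t\<^sub>0"
  assume "\<not> ?thesis"
  then have strict: "perron (x\<^sub>0, t\<^sub>0) - perron (y, s) < (t\<^sub>0 - s) * (\<phi> (dist x\<^sub>0 y / (t\<^sub>0 - s)) - \<epsilon>)"
    if "0 < s" "s < t\<^sub>0" "dist (y, s) (x\<^sub>0, t\<^sub>0) < \<delta>" for y s
    using that unfolding \<phi>_def by force
  obtain \<eta> where \<eta>: "\<eta> > 0" "\<And>x y t s q. t \<in> {0<..<T} \<Longrightarrow> s \<in> {0<..<T} \<Longrightarrow> q \<in> {0..Q} \<Longrightarrow>
     dist x y + \<bar>t - s\<bar> < \<eta> \<Longrightarrow> \<bar>L x t q - L y s q\<bar> \<le> \<epsilon> / 2"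
    using oscillation[of "\<epsilon> / 2"] e by auto
  \<comment> \<open>The height of the cone, small enough for the cone to lie in both neighbourhoods.\<close>
  define h where "h = min (t\<^sub>0 / 2) (min \<delta> \<eta> / (2 * (Q + 1)))"
  define r where "r = t\<^sub>0 - h"
  have h: "h > 0" "h < t\<^sub>0" using t \<delta> \<eta>(1) Q by (auto simp: h_def)
  have "(Q + 1) * h \<le> (Q + 1) * (min \<delta> \<eta> / (2 * (Q + 1)))"
    using Q by (intro mult_left_mono) (auto simp: h_def)
  also have "\<dots> = min \<delta> \<eta> / 2" using Q by (simp add: field_simps)
  finally have hsmall: "(Q + 1) * h < \<delta>" "(Q + 1) * h < \<eta>" using \<delta> \<eta>(1) by linarith+
  have r: "0 < r" "r < t\<^sub>0" using h by (auto simp: r_def)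
  define D where "D = {(x, t). r \<le> t \<and> t \<le> t\<^sub>0 \<and> dist x\<^sub>0 x \<le> Q * (t\<^sub>0 - t)}"
  define base where "base = perron (x\<^sub>0, t\<^sub>0) + h * (\<epsilon> / 2)"
  define g where "g = (\<lambda>(x, t). base - (t\<^sub>0 - t) * (\<phi> (dist x\<^sub>0 x / (t\<^sub>0 - t)) - \<epsilon> / 2))"
  have small: "dist x\<^sub>0 x + \<bar>t\<^sub>0 - t\<bar> \<le> (Q + 1) * h" if "(x, t) \<in> D" for x t
  proof -
    have "dist x\<^sub>0 x + \<bar>t\<^sub>0 - t\<bar> \<le> (Q + 1) * (t\<^sub>0 - t)" using that by (simp add: D_def algebra_simps)
    also have "\<dots> \<le> (Q + 1) * h" using that Q by (intro mult_left_mono) (auto simp: D_def r_def)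
    finally show ?thesis .
  qed
  have "g (x\<^sub>0, t\<^sub>0) \<le> perron (x\<^sub>0, t\<^sub>0)"
  proof (rule le_perron_if_dominated[where D = D and r = r])
    show "dominated D g"
      unfolding dominated_def
    proof (intro allI impI, elim conjE)
      fix y s x t q c
      assume 1: "(y, s) \<in> D" "(x, t) \<in> D" "s < t" "0 < q" "q \<le> Q"
        "dist y x < q * (t - s)" and c: "diamond_bound y s x t q c"
      have "\<phi> q \<le> L x t q + \<epsilon> / 2"
      proof -
        have "\<bar>L x\<^sub>0 t\<^sub>0 q - L x t q\<bar> \<le> \<epsilon> / 2"
          using small[OF 1(2)] hsmall 1 r t by (intro \<eta>(2)) (auto simp: D_def)
        then show ?thesis unfolding \<phi>_def by linarith
      qed
      also have "L x t q \<le> c" by (rule diamond_bound_end[OF c 1(3,6)])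
      finally have "(t - s) * \<phi> q \<le> (t - s) * (c + \<epsilon> / 2)" using 1 by (intro mult_left_mono) auto
      moreover have "(t\<^sub>0 - t + (t - s)) * \<phi> (dist x\<^sub>0 y / (t\<^sub>0 - t + (t - s)))
        \<le> (t\<^sub>0 - t) * \<phi> (dist x\<^sub>0 x / (t\<^sub>0 - t)) + (t - s) * \<phi> q"
      proof (rule perspective_subadditive)
        show "convex_on {0..} \<phi>" "mono_on {0..} \<phi>" using convex mono t by (auto simp: \<phi>_def)
        show "dist x\<^sub>0 y \<le> dist x\<^sub>0 x + q * (t - s)"
          using dist_triangle[of x\<^sub>0 y x] 1(6) by (simp add: dist_commute)
      qed (use 1 in \<open>auto simp: D_def\<close>)
      ultimately show "g (x, t) \<le> g (y, s) + (t - s) * c"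
        by (simp add: g_def algebra_simps) argo
    qed
    show "D \<subseteq> UNIV \<times> {r..<T}" using t by (auto simp: D_def)
    show "(y, s) \<in> D" if "(x, t) \<in> D" "r \<le> s" "s < t" "dist y x < Q * (t - s)" for x t y s
      using that dist_triangle[of x\<^sub>0 y x] by (simp add: D_def dist_commute algebra_simps)
    show "g (y, r) \<le> perron (y, r)" if "(y, r) \<in> D" for y
    proof -
      have "dist (y, r) (x\<^sub>0, t\<^sub>0) \<le> dist x\<^sub>0 y + \<bar>t\<^sub>0 - r\<bar>"
        using dist_Pair_le_sum[of y r x\<^sub>0 t\<^sub>0] by (simp add: dist_commute abs_minus_commute)
      then have "dist (y, r) (x\<^sub>0, t\<^sub>0) < \<delta>" using small[OF that] hsmall by linarith
      from strict[OF r this] show ?thesis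
        by (simp add: g_def base_def r_def algebra_simps)
    qed
    show "(x\<^sub>0, t\<^sub>0) \<in> D" using r by (simp add: D_def)
  qed (use r in auto)
  then show False using mult_pos_pos[OF h(1) e] by (simp add: g_def base_def)
qed

lemma perron_solves:
  assumes bounded: "bounded (range u0)" and large: "\<And>q. q \<ge> Q \<Longrightarrow> K * (q + 1) \<le> m q"
    and L: "L = Lagrangian H"
  shows "bounded_Monge_solution_with_data T H u0 perron"
  unfolding bounded_Monge_solution_with_data_def
proof (intro conjI)
  obtain M where M: "\<forall>x. \<bar>u0 x\<bar> \<le> M" using bounded by (auto simp: bounded_iff)
  have near: "\<bar>perron (x, t) - u0 x\<bar> \<le> (C\<^sub>0 + B\<^sub>2) * t" if "0 \<le> t" "t < T" for x t
  proof -
    have "0 \<le> C\<^sub>0 * t" "0 \<le> B\<^sub>2 * t" using C\<^sub>0 B\<^sub>2 that by auto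
    then show ?thesis using perron_barriers[OF that, of x] by (simp add: algebra_simps abs_le_iff)
  qed
  have "\<bar>perron (x, t)\<bar> \<le> M + (C\<^sub>0 + B\<^sub>2) * T" if "0 \<le> t" "t < T" for x t
  proof -
    have "(C\<^sub>0 + B\<^sub>2) * t \<le> (C\<^sub>0 + B\<^sub>2) * T" using that C\<^sub>0 B\<^sub>2 by (intro mult_left_mono) auto
    then show ?thesis using near[OF that, of x] spec[OF M, of x] by linarith
  qed
  then show "bounded (perron ` (UNIV \<times> {0..<T}))"
    unfolding bounded_iff by (intro exI[of _ "M + (C\<^sub>0 + B\<^sub>2) * T"]) auto
  show lip: "Lip (UNIV \<times> {0..<T}) perron"
    unfolding Lip_iff_max
  proof (intro exI[of _ "K * 2"] conjI ballI)
    fix z w :: "'a \<times> real" assume "z \<in> UNIV \<times> {0..<T}" "w \<in> UNIV \<times> {0..<T}"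
    then have "\<bar>perron z - perron w\<bar> \<le> K * (dist (fst z) (fst w) + \<bar>snd z - snd w\<bar>)"
      using U_Lipschitz[of "snd w" "snd z" "fst z" "fst w"] by auto
    also have "\<dots> \<le> K * (2 * max (dist (fst z) (fst w)) \<bar>snd z - snd w\<bar>)"
      using K_nonneg by (intro mult_left_mono) (auto simp: max_def)
    finally show "\<bar>perron z - perron w\<bar> \<le> K * 2 * max (dist (fst z) (fst w)) \<bar>snd z - snd w\<bar>" by simp
  qed (use K_nonneg in simp)
  have "Lip_loc (space_time T) perron"
    unfolding Lip_loc_def
  proof (intro ballI exI[of _ 1] conjI)
    fix z :: "'a \<times> real"
    have "ball z 1 \<inter> space_time T \<subseteq> UNIV \<times> {0..<T}" by (auto simp: space_time_def)
    then show "Lip (ball z 1 \<inter> space_time T) perron"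
      using lip unfolding Lip_def by (meson lipschitz_on_subset)
  qed simp
  moreover have "- K * (t - s) \<le> perron (x, t) - perron (x, s)" if "0 < s \<and> s < t \<and> t < T" for x s t
    using U_Lipschitz[of s t x x] that by simp
  ultimately have S: "perron \<in> S_class T K" by (auto simp: S_class_def)
  have "Monge_slope T (Lagrangian H) (\<lambda>(y, s). perron (y, s) + K * s) x t = ereal K"
    if "0 < t" "t < T" for x t
    unfolding Monge_slope_eq_iff[OF that] L[symmetric]
    by (intro conjI allI impI perron_subsolution[OF that _ large] perron_supersolution[OF that])
  then show "Monge_solution T H perron"
    using S K_nonneg by (auto simp: Monge_solution_def S_union_def space_time_def)
  show "((\<lambda>t. SUP x. ereal \<bar>perron (x, t) - u0 x\<bar>) \<longlongrightarrow> 0) (at_right 0)"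
  proof (rule tendsto_sandwich)
    have ev: "eventually (\<lambda>t. t \<in> {0<..<T}) (at_right 0)"
      using T by (rule eventually_at_right_real)
    show "eventually (\<lambda>t. 0 \<le> (SUP x. ereal \<bar>perron (x, t) - u0 x\<bar>)) (at_right 0)"
      by (intro always_eventually allI SUP_upper2) auto
    show "eventually (\<lambda>t. (SUP x. ereal \<bar>perron (x, t) - u0 x\<bar>) \<le> ereal ((C\<^sub>0 + B\<^sub>2) * t)) (at_right 0)"
      using ev by eventually_elim (use near in \<open>auto intro!: SUP_least\<close>)
    show "((\<lambda>t. ereal ((C\<^sub>0 + B\<^sub>2) * t)) \<longlongrightarrow> 0) (at_right 0)"
      unfolding zero_ereal_def by (intro tendsto_ereal) (auto intro!: tendsto_eq_intros)
  qed simp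
qed

end

section \<open>Comparison of solutions\<close>

text \<open>Backward steps are followed greedily: each one descends at least half as far in time as
  possible. Bounded speed and completeness give a limit point, which is reachable from every point
  of the sequence. A further step from a limit at positive time would have been available all
  along and is excluded by greed.\<close>

lemma descend_to_initial_time:
  fixes f :: "'a::complete_space \<times> real \<Rightarrow> real"
  assumes cont: "continuous_on (UNIV \<times> {0..<T}) f" and Q: "Q \<ge> 0"
    and step: "\<And>x t. 0 < t \<Longrightarrow> t < T \<Longrightarrow>
      \<exists>y s. 0 \<le> s \<and> s < t \<and> dist x y \<le> Q * (t - s) \<and> f (x, t) \<le> f (y, s) + \<epsilon> * (t - s)"
    and t: "0 \<le> t" "t < T"
  shows "\<exists>y. f (x, t) \<le> f (y, 0) + \<epsilon> * t"
proof -
  define reach where "reach z w \<longleftrightarrow> 0 \<le> snd w \<and> snd w \<le> snd z \<and>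
    dist (fst z) (fst w) \<le> Q * (snd z - snd w) \<and> f z \<le> f w + \<epsilon> * (snd z - snd w)" for z w
  have refl: "reach z z" if "0 \<le> snd z" for z using that by (simp add: reach_def)
  have trans: "reach a c" if "reach a b" "reach b c" for a b c
    using that dist_triangle[of "fst a" "fst c" "fst b"] by (auto simp: reach_def algebra_simps)
  have "\<exists>Z. \<forall>n. reach (x, t) (Z n) \<and>
    (reach (Z n) (Z (Suc n)) \<and> (\<forall>v. reach (Z n) v \<longrightarrow> snd (Z (Suc n)) \<le> (snd (Z n) + snd v) / 2))"
  proof (rule dependent_nat_choice)
    show "\<exists>z. reach (x, t) z" using refl[of "(x, t)"] t by auto
    fix z assume z: "reach (x, t) z"
    define I where "I = Inf (snd ` Collect (reach z))"
    have zz: "reach z z" using refl z by (simp add: reach_def)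
    then have ne: "Collect (reach z) \<noteq> {}" by blast
    have "bdd_below (snd ` Collect (reach z))"
      by (auto simp: bdd_below_def reach_def intro!: exI[of _ 0])
    then have I: "I \<le> snd v" if "reach z v" for v
      using that unfolding I_def by (intro cInf_lower) auto
    have "\<exists>w. reach z w \<and> (\<forall>v. reach z v \<longrightarrow> snd w \<le> (snd z + snd v) / 2)"
    proof (cases "I < snd z")
      case True
      then have "Inf (snd ` Collect (reach z)) < (snd z + I) / 2" by (simp add: I_def)
      then have "\<exists>b\<in>snd ` Collect (reach z). b < (snd z + I) / 2"
        using ne by (intro cInf_lessD) auto
      then obtain w where "reach z w" "snd w < (snd z + I) / 2" by blast
      then show ?thesis using I by (intro exI[of _ w]) force
    next
      case False
      then have "snd z \<le> snd v" if "reach z v" for v using I[OF that] by simp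
      then show ?thesis using zz by (intro exI[of _ z]) force
    qed
    then show "\<exists>w. reach (x, t) w \<and> (reach z w \<and> (\<forall>v. reach z v \<longrightarrow> snd w \<le> (snd z + snd v) / 2))"
      using trans z by blast
  qed
  then obtain Z where Z: "\<And>n. reach (x, t) (Z n)" "\<And>n. reach (Z n) (Z (Suc n))"
    "\<And>n v. reach (Z n) v \<Longrightarrow> snd (Z (Suc n)) \<le> (snd (Z n) + snd v) / 2" by blast
  define X \<tau> where "X n = fst (Z n)" and "\<tau> n = snd (Z n)" for n
  have Zeq: "Z n = (X n, \<tau> n)" for n by (simp add: X_def \<tau>_def)
  have \<tau>: "0 \<le> \<tau> n" "\<tau> n < T" for n using Z(1)[of n] t by (auto simp: reach_def Zeq)
  have chain: "reach (Z i) (Z j)" if "i \<le> j" for i j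
    using that
  proof (induction j rule: dec_induct)
    case base
    show ?case using refl \<tau> by (simp add: \<tau>_def)
  next
    case (step n)
    then show ?case using trans Z(2) by blast
  qed
  have "decseq \<tau>" using chain by (auto simp: decseq_def reach_def \<tau>_def)
  then obtain tl where tl: "\<tau> \<longlonglongrightarrow> tl" using decseq_convergent[of \<tau> 0] \<tau> by blast
  have "Cauchy X"
  proof (rule metric_CauchyI)
    fix e :: real assume "e > 0"
    then obtain N where N: "\<And>i j. i \<ge> N \<Longrightarrow> j \<ge> N \<Longrightarrow> dist (\<tau> i) (\<tau> j) < e / (Q + 1)"
      using LIMSEQ_imp_Cauchy[OF tl] Q unfolding Cauchy_def by (metis add_pos_nonneg add.commute divide_pos_pos zero_less_one)
    have D: "dist (X i) (X j) \<le> (Q + 1) * dist (\<tau> i) (\<tau> j)" for i j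
    proof -
      have "dist (X i) (X j) \<le> Q * dist (\<tau> i) (\<tau> j)"
        using chain[of i j] chain[of j i] by (cases "i \<le> j") (auto simp: reach_def Zeq dist_real_def dist_commute)
      then show ?thesis using zero_le_dist[of "\<tau> i" "\<tau> j"] unfolding distrib_right by linarith
    qed
    have "dist (X i) (X j) < e" if "i \<ge> N" "j \<ge> N" for i j
      using D[of i j] N[OF that] Q by (simp add: pos_less_divide_eq mult.commute)
    then show "\<exists>M. \<forall>i\<ge>M. \<forall>j\<ge>M. dist (X i) (X j) < e" by blast
  qed
  then obtain xl where xl: "X \<longlonglongrightarrow> xl" using Cauchy_convergent convergent_def by blast
  have tl0: "0 \<le> tl" using \<tau> by (intro LIMSEQ_le_const[OF tl]) auto
  have tl\<tau>: "tl \<le> \<tau> n" for n using decseq_ge[OF \<open>decseq \<tau>\<close> tl] .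
  then have tlT: "tl < T" using \<tau>(2) by (meson order_le_less_trans)
  have lim: "(\<lambda>n. f (X n, \<tau> n)) \<longlonglongrightarrow> f (xl, tl)"
    by (rule continuous_on_tendsto_compose[OF cont tendsto_Pair[OF xl tl]])
      (use tl0 tlT \<tau> in auto)
  have limit_reached: "reach (Z n) (xl, tl)" for n
    unfolding reach_def
  proof (intro conjI)
    have ev: "eventually (\<lambda>j. reach (Z n) (Z j)) sequentially"
      by (rule eventually_sequentiallyI[of n]) (rule chain)
    show "dist (fst (Z n)) (fst (xl, tl)) \<le> Q * (snd (Z n) - snd (xl, tl))"
    proof (rule tendsto_le[OF sequentially_bot])
      show "(\<lambda>j. Q * (snd (Z n) - \<tau> j)) \<longlonglongrightarrow> Q * (snd (Z n) - snd (xl, tl))"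
        using tl by (auto intro!: tendsto_intros)
      show "(\<lambda>j. dist (fst (Z n)) (X j)) \<longlonglongrightarrow> dist (fst (Z n)) (fst (xl, tl))"
        using xl by (auto intro!: tendsto_intros)
      show "\<forall>\<^sub>F j in sequentially. dist (fst (Z n)) (X j) \<le> Q * (snd (Z n) - \<tau> j)"
        using ev by (auto elim!: eventually_mono simp: reach_def Zeq)
    qed
    show "f (Z n) \<le> f (xl, tl) + \<epsilon> * (snd (Z n) - snd (xl, tl))"
    proof (rule tendsto_le[OF sequentially_bot])
      show "(\<lambda>j. f (X j, \<tau> j) + \<epsilon> * (snd (Z n) - \<tau> j)) \<longlonglongrightarrow> f (xl, tl) + \<epsilon> * (snd (Z n) - snd (xl, tl))"
        using lim tl by (auto intro!: tendsto_intros)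
      show "(\<lambda>j. f (Z n)) \<longlonglongrightarrow> f (Z n)" by simp
      show "\<forall>\<^sub>F j in sequentially. f (Z n) \<le> f (X j, \<tau> j) + \<epsilon> * (snd (Z n) - \<tau> j)"
        using ev by (auto elim!: eventually_mono simp: reach_def Zeq)
    qed
  qed (use tl0 tl\<tau> in \<open>auto simp: \<tau>_def\<close>)
  have "tl = 0"
  proof (rule ccontr)
    assume "tl \<noteq> 0"
    then obtain y s where ys: "0 \<le> s" "s < tl" "dist xl y \<le> Q * (tl - s)"
      "f (xl, tl) \<le> f (y, s) + \<epsilon> * (tl - s)"
      using step[of tl xl] tl0 tlT by auto
    then have "reach (xl, tl) (y, s)" by (simp add: reach_def)
    then have "\<tau> (Suc n) \<le> (\<tau> n + s) / 2" for n
      using Z(3)[OF trans[OF limit_reached]] by (force simp: \<tau>_def)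
    then have "tl \<le> (tl + s) / 2"
      using LIMSEQ_Suc[OF tl] tl
      by (intro tendsto_le[OF sequentially_bot, of "\<lambda>n. (\<tau> n + s) / 2" _ "\<lambda>n. \<tau> (Suc n)"])
        (auto intro!: tendsto_intros)
    then show False using ys(2) by simp
  qed
  then have "reach (x, t) (xl, 0)" using trans[OF Z(1) limit_reached] by blast
  then show ?thesis by (auto simp: reach_def)
qed

lemma Lip_Pair:
  fixes u :: "'a::metric_space \<times> real \<Rightarrow> real"
  assumes "Lip S u"
  obtains K where "K \<ge> 0" "\<And>x t y s. (x, t) \<in> S \<Longrightarrow> (y, s) \<in> S \<Longrightarrow>
    \<bar>u (x, t) - u (y, s)\<bar> \<le> K * (dist x y + \<bar>t - s\<bar>)"
proof -
  obtain K where K: "K-lipschitz_on S u" using assms by (auto simp: Lip_def)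
  show ?thesis
  proof
    show "K \<ge> 0" using K lipschitz_on_nonneg by blast
    fix x t y s assume "(x, t) \<in> S" "(y, s) \<in> S"
    then have "\<bar>u (x, t) - u (y, s)\<bar> \<le> K * dist (x, t) (y, s)"
      using lipschitz_onD[OF K] by (simp add: dist_real_def)
    also have "\<dots> \<le> K * (dist x y + \<bar>t - s\<bar>)"
      using \<open>K \<ge> 0\<close> dist_Pair_le_sum by (intro mult_left_mono) auto
    finally show "\<bar>u (x, t) - u (y, s)\<bar> \<le> K * (dist x y + \<bar>t - s\<bar>)" .
  qed
qed

lemma Lip_imp_continuous_on: "Lip S u \<Longrightarrow> continuous_on S u"
  by (auto simp: Lip_def intro: lipschitz_on_continuous_on)

text \<open>At each point the subsolution inequality holds in a whole neighbourhood, and the supersolution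
  inequality provides a point in that same neighbourhood. Subtracting, \<open>u - w\<close> loses at most
  \<open>2 \<epsilon> (t - s)\<close>, and the Lagrangian cancels.\<close>

lemma Monge_comparison:
  fixes u w :: "'a::complete_space \<times> real \<Rightarrow> real"
  assumes lower: "\<And>x t q. 0 < t \<Longrightarrow> t < T \<Longrightarrow> q \<ge> 0 \<Longrightarrow> m q \<le> L x t q"
    and superlinear: "filterlim (\<lambda>q. m q / q) at_top at_top"
    and Lip: "Lip (UNIV \<times> {0..<T}) u" "Lip (UNIV \<times> {0..<T}) w"
    and sub: "\<And>x t \<epsilon>. 0 < t \<Longrightarrow> t < T \<Longrightarrow> \<epsilon> > 0 \<Longrightarrow>
      \<exists>\<delta>>0. \<forall>y s. 0 < s \<and> s < t \<and> dist (y, s) (x, t) < \<delta> \<longrightarrow>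
        u (x, t) - u (y, s) \<le> (t - s) * (L x t (dist x y / (t - s)) + \<epsilon>)"
    and super: "\<And>x t \<epsilon> \<delta>. 0 < t \<Longrightarrow> t < T \<Longrightarrow> \<epsilon> > 0 \<Longrightarrow> \<delta> > 0 \<Longrightarrow>
      \<exists>y s. 0 < s \<and> s < t \<and> dist (y, s) (x, t) < \<delta> \<and>
        w (x, t) - w (y, s) \<ge> (t - s) * (L x t (dist x y / (t - s)) - \<epsilon>)"
    and initial: "\<And>x. u (x, 0) \<le> w (x, 0)"
    and t: "0 \<le> t" "t < T"
  shows "u (x, t) \<le> w (x, t)"
proof (rule field_le_epsilon)
  fix e :: real assume e: "e > 0"
  obtain K where K: "K \<ge> 0" "\<And>x t y s. (x, t) \<in> UNIV \<times> {0..<T} \<Longrightarrow> (y, s) \<in> UNIV \<times> {0..<T} \<Longrightarrow>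
    \<bar>w (x, t) - w (y, s)\<bar> \<le> K * (dist x y + \<bar>t - s\<bar>)"
    using Lip_Pair[OF Lip(2)] by blast
  obtain Q where Q: "Q \<ge> 2" "\<And>q. q \<ge> Q \<Longrightarrow> m q > K * (q + 1) + 1"
    using superlinear_exceeds_affine[OF superlinear K(1)] by blast
  have T: "T > 0" using t by simp
  define \<epsilon> where "\<epsilon> = min 1 (e / (2 * T))"
  have \<epsilon>: "0 < \<epsilon>" "\<epsilon> \<le> 1" using e T by (auto simp: \<epsilon>_def)
  have \<epsilon>T: "2 * \<epsilon> * T \<le> e"
  proof -
    have "2 * \<epsilon> * T \<le> 2 * (e / (2 * T)) * T" using T by (intro mult_right_mono mult_left_mono) (auto simp: \<epsilon>_def)
    then show ?thesis using T by simp
  qed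
  let ?f = "\<lambda>z. u z - w z"
  have "\<exists>y. ?f (x, t) \<le> ?f (y, 0) + (2 * \<epsilon>) * t"
  proof (rule descend_to_initial_time[OF _ _ _ t])
    show "continuous_on (UNIV \<times> {0..<T}) ?f"
      using Lip by (intro continuous_intros Lip_imp_continuous_on)
    show "0 \<le> Q" using Q by simp
    fix x t assume t: "0 < t" "t < T"
    obtain \<delta> where \<delta>: "\<delta> > 0" "\<And>y s. 0 < s \<and> s < t \<and> dist (y, s) (x, t) < \<delta> \<Longrightarrow>
        u (x, t) - u (y, s) \<le> (t - s) * (L x t (dist x y / (t - s)) + \<epsilon>)"
      using sub[OF t \<epsilon>(1)] by blast
    obtain y s where ys: "0 < s" "s < t" "dist (y, s) (x, t) < \<delta>"
      "w (x, t) - w (y, s) \<ge> (t - s) * (L x t (dist x y / (t - s)) - \<epsilon>)"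
      using super[OF t \<epsilon>(1) \<delta>(1)] by blast
    define h q where "h = t - s" and "q = dist x y / h"
    have h: "h > 0" "q \<ge> 0" "dist x y = q * h" using ys by (auto simp: h_def q_def)
    have "?f (x, t) \<le> ?f (y, s) + 2 * \<epsilon> * h"
      using \<delta>(2)[of s y] ys by (simp add: h_def algebra_simps)
    \<comment> \<open>A faster step would cost more than the Lipschitz function \<open>w\<close> can vary.\<close>
    moreover have "q \<le> Q"
    proof (rule ccontr)
      assume "\<not> q \<le> Q"
      then have "K * (q + 1) + 1 < L x t q" using Q(2)[of q] lower[OF t h(2), of x] by simp
      then have "h * (K * (q + 1)) < h * (L x t q - \<epsilon>)" using h \<epsilon> by (intro mult_strict_left_mono) auto
      also have "\<dots> \<le> w (x, t) - w (y, s)" using ys(4) by (simp add: h_def q_def)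
      also have "\<dots> \<le> K * (dist x y + h)" using K(2)[of x t y s] t ys by (simp add: h_def)
      also have "\<dots> = h * (K * (q + 1))" by (simp add: h(3) algebra_simps)
      finally show False by simp
    qed
    then have "dist x y \<le> Q * h" using h by (simp add: mult_right_mono)
    ultimately show "\<exists>y s. 0 \<le> s \<and> s < t \<and> dist x y \<le> Q * (t - s) \<and>
        ?f (x, t) \<le> ?f (y, s) + (2 * \<epsilon>) * (t - s)"
      using ys by (intro exI[of _ y] exI[of _ s]) (simp add: h_def)
  qed
  then obtain y where "?f (x, t) \<le> ?f (y, 0) + 2 * \<epsilon> * t" by blast
  moreover have "2 * \<epsilon> * t \<le> 2 * \<epsilon> * T" using \<epsilon> t by (intro mult_left_mono) auto
  ultimately show "u (x, t) \<le> w (x, t) + e" using initial[of y] \<epsilon>T by linarith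
qed

lemma initial_value:
  fixes w :: "'a::metric_space \<times> real \<Rightarrow> real"
  assumes T: "T > 0" and Lip: "Lip (UNIV \<times> {0..<T}) w"
    and lim: "((\<lambda>t. SUP x. ereal \<bar>w (x, t) - u0 x\<bar>) \<longlongrightarrow> 0) (at_right 0)"
  shows "w (x, 0) = u0 x"
proof -
  obtain K where K: "K \<ge> 0" "\<And>x t y s. (x, t) \<in> UNIV \<times> {0..<T} \<Longrightarrow> (y, s) \<in> UNIV \<times> {0..<T} \<Longrightarrow>
    \<bar>w (x, t) - w (y, s)\<bar> \<le> K * (dist x y + \<bar>t - s\<bar>)"
    using Lip_Pair[OF Lip] by blast
  have "\<bar>w (x, 0) - u0 x\<bar> \<le> 0 + e" if e: "e > 0" for e
  proof -
    have "eventually (\<lambda>t. (SUP x. ereal \<bar>w (x, t) - u0 x\<bar>) < ereal (e / 2)) (at_right 0)"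
      using order_tendstoD(2)[OF lim, of "ereal (e / 2)"] e by simp
    moreover have "eventually (\<lambda>t. t \<in> {0<..<min T (e / (2 * (K + 1)))}) (at_right 0)"
      using T e K by (intro eventually_at_right_real) auto
    ultimately have "\<exists>t. (SUP x. ereal \<bar>w (x, t) - u0 x\<bar>) < ereal (e / 2) \<and>
      t \<in> {0<..<min T (e / (2 * (K + 1)))}"
      by (intro eventually_happens'[of "at_right (0::real)"] eventually_conj) simp_all
    then obtain t where t: "(SUP x. ereal \<bar>w (x, t) - u0 x\<bar>) < ereal (e / 2)"
      "0 < t" "t < T" "t < e / (2 * (K + 1))" by auto
    have "ereal \<bar>w (x, t) - u0 x\<bar> \<le> (SUP x. ereal \<bar>w (x, t) - u0 x\<bar>)" by (rule SUP_upper) simp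
    with t(1) have "ereal \<bar>w (x, t) - u0 x\<bar> < ereal (e / 2)" by order
    then have "\<bar>w (x, t) - u0 x\<bar> < e / 2" by simp
    moreover have "\<bar>w (x, 0) - w (x, t)\<bar> \<le> K * t" using K(2)[of x 0 x t] t T by simp
    moreover have "t * (2 * (K + 1)) < e" using t(4) K by (simp add: pos_less_divide_eq)
    then have "2 * (K * t) < e" using t(2) by (simp add: algebra_simps)
    ultimately show ?thesis by linarith
  qed
  then have "\<bar>w (x, 0) - u0 x\<bar> \<le> 0" by (rule field_le_epsilon)
  then show ?thesis by simp
qed

lemma solution_is_semisolution:
  assumes sol: "bounded_Monge_solution_with_data T H u0 w" and t: "0 < t" "t < T"
  shows "\<epsilon> > 0 \<Longrightarrow> \<exists>\<delta>>0. \<forall>y s. 0 < s \<and> s < t \<and> dist (y, s) (x, t) < \<delta> \<longrightarrow>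
        w (x, t) - w (y, s) \<le> (t - s) * (Lagrangian H x t (dist x y / (t - s)) + \<epsilon>)"
    and "\<epsilon> > 0 \<Longrightarrow> \<delta> > 0 \<Longrightarrow> \<exists>y s. 0 < s \<and> s < t \<and> dist (y, s) (x, t) < \<delta> \<and>
        w (x, t) - w (y, s) \<ge> (t - s) * (Lagrangian H x t (dist x y / (t - s)) - \<epsilon>)"
proof -
  obtain k where k: "\<forall>(x, t)\<in>space_time T.
      Monge_slope T (Lagrangian H) (\<lambda>(y, s). w (y, s) + k * s) x t = ereal k"
    using sol unfolding bounded_Monge_solution_with_data_def Monge_solution_def by blast
  have "Monge_slope T (Lagrangian H) (\<lambda>(y, s). w (y, s) + k * s) x t = ereal k"
    using bspec[OF k, of "(x, t)"] t by (simp add: space_time_def)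
  note * = this[unfolded Monge_slope_eq_iff[OF t]]
  show "\<epsilon> > 0 \<Longrightarrow> \<exists>\<delta>>0. \<forall>y s. 0 < s \<and> s < t \<and> dist (y, s) (x, t) < \<delta> \<longrightarrow>
        w (x, t) - w (y, s) \<le> (t - s) * (Lagrangian H x t (dist x y / (t - s)) + \<epsilon>)"
    by (rule *[THEN conjunct1, rule_format])
  show "\<epsilon> > 0 \<Longrightarrow> \<delta> > 0 \<Longrightarrow> \<exists>y s. 0 < s \<and> s < t \<and> dist (y, s) (x, t) < \<delta> \<and>
        w (x, t) - w (y, s) \<ge> (t - s) * (Lagrangian H x t (dist x y / (t - s)) - \<epsilon>)"
    by (rule *[THEN conjunct2, rule_format])
qed

section \<open>Existence and uniqueness\<close>

theorem theorem1p2: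
  fixes H :: "'a::complete_space \<Rightarrow> real \<Rightarrow> real \<Rightarrow> real"
    and m :: "real \<Rightarrow> real" and u0 :: "'a \<Rightarrow> real" and T :: real
  assumes "length_space TYPE('a)"
    and "T > 0"
    and "jointly_continuous T H"
    and "cond_H1 T H"
    and "jointly_continuous T (Lagrangian H)"
    and "cond_H2 T (Lagrangian H) m"
    and "cond_H3 T (Lagrangian H)"
    and "cond_H4 T (Lagrangian H) m"
    and "cond_H5 T (Lagrangian H)"
    and "bounded (range u0)"
    and "Lip UNIV u0"
  shows "\<exists>u. bounded_Monge_solution_with_data T H u0 u \<and>
           (\<forall>w. bounded_Monge_solution_with_data T H u0 w \<longrightarrow>
              (\<forall>z\<in>UNIV \<times> {0..<T}. w z = u z))"
proof -
  let ?L = "Lagrangian H"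
  note H1 = \<open>cond_H1 T H\<close> and T = \<open>T > 0\<close>
  have m: "continuous_on UNIV m" "filterlim (\<lambda>q. m q / q) at_top at_top"
    using \<open>cond_H2 T ?L m\<close> by (auto simp: cond_H2_def)
  have lower: "m q \<le> ?L x t q" if "0 < t" "t < T" "q \<ge> 0" for x t q
  proof -
    have "ereal (m q) \<le> (INF (x, t) \<in> UNIV \<times> {0<..<T}. ereal (?L x t q))"
      using \<open>cond_H2 T ?L m\<close> that by (auto simp: cond_H2_def)
    also have "\<dots> \<le> ereal (?L x t q)" by (rule INF_lower2[of "(x, t)"]) (use that in auto)
    finally show ?thesis by simp
  qed
  have "\<exists>B\<ge>0. \<forall>x. \<forall>t\<in>{0<..<T}. ?L x t 2 \<le> B"
    by (rule Lagrangian_bounded_above[OF H1 \<open>cond_H3 T ?L\<close>]) simp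
  then obtain B\<^sub>2 where B\<^sub>2: "B\<^sub>2 \<ge> 0" "\<And>x t. t \<in> {0<..<T} \<Longrightarrow> ?L x t 2 \<le> B\<^sub>2"
    by blast
  obtain C\<^sub>T where C\<^sub>T: "C\<^sub>T > 0" "\<And>x t s q. t \<in> {0<..<T} \<Longrightarrow> s \<in> {0<..<T} \<Longrightarrow> q \<ge> 0 \<Longrightarrow>
      \<bar>?L x t q - ?L x s q\<bar> \<le> C\<^sub>T * \<bar>t - s\<bar>"
    using \<open>cond_H5 T ?L\<close> unfolding cond_H5_def by blast
  obtain \<Lambda> where \<Lambda>: "\<Lambda>-lipschitz_on UNIV u0" using \<open>Lip UNIV u0\<close> by (auto simp: Lip_def)
  have \<Lambda>0: "\<Lambda> \<ge> 0" using \<Lambda> lipschitz_on_nonneg by blast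
  obtain C\<^sub>0 where C\<^sub>0: "C\<^sub>0 \<ge> 0" "\<And>q. q \<ge> 0 \<Longrightarrow> \<Lambda> * q - C\<^sub>0 \<le> m q"
    using superlinear_above_affine[OF m(2,1) \<Lambda>0] by blast
  define K where "K = \<Lambda> + C\<^sub>0 + C\<^sub>T * T + 2 * B\<^sub>2"
  have "K \<ge> 0" using \<Lambda>0 C\<^sub>0 C\<^sub>T B\<^sub>2 T by (simp add: K_def)
  \<comment> \<open>The maximal speed comes last: from \<open>Q\<close> on, motion costs more than a function with Lipschitz
    constant \<open>K\<close> can vary.\<close>
  then obtain Q where Q: "Q \<ge> 2" "\<And>q. q \<ge> Q \<Longrightarrow> m q > K * (q + 1) + 1"
    using superlinear_exceeds_affine[OF m(2)] by blast
  interpret P: perron_problem ?L T m C\<^sub>T B\<^sub>2 u0 \<Lambda> C\<^sub>0 Q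
  proof
    show "\<exists>z. dist y z < q * a \<and> dist z x < q * b"
      if "dist y x < q * (a + b)" "a > 0" "b > 0" for y x :: 'a and q a b
      using length_space_split[OF \<open>length_space TYPE('a)\<close> that] .
    show "continuous_on {0..} (?L x t)" if "0 < t" "t < T" for x t
    proof -
      have "continuous_on (UNIV \<times> {0<..<T} \<times> {0..}) (\<lambda>(x, t, q). ?L x t q)"
        using \<open>jointly_continuous T ?L\<close> by (simp add: jointly_continuous_def)
      then have "continuous_on {0..} (\<lambda>q. case (x, t, q) of (x, t, q) \<Rightarrow> ?L x t q)"
        by (rule continuous_on_compose2[where f = "\<lambda>q. (x, t, q)"])
          (use that in \<open>auto intro!: continuous_intros\<close>)
      then show ?thesis by simp
    qed
    show "\<exists>\<delta>>0. \<forall>x y. \<forall>t\<in>{0<..<T}. \<forall>s\<in>{0<..<T}. \<forall>q\<in>{0..Q}.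
           dist x y + \<bar>t - s\<bar> < \<delta> \<longrightarrow> \<bar>?L x t q - ?L y s q\<bar> \<le> \<epsilon>" if "\<epsilon> > 0" for \<epsilon>
      using cond_H4_locally_uniform[OF \<open>cond_H4 T ?L m\<close> m(1) that] .
    show "\<bar>u0 x - u0 y\<bar> \<le> \<Lambda> * dist x y" for x y
      using lipschitz_onD[OF \<Lambda>] by (simp add: dist_real_def)
    show "convex_on {0..} (?L x t)" "mono_on {0..} (?L x t)" "?L x t 2 \<le> B\<^sub>2"
      if "0 < t" "t < T" for x t
      using Lagrangian_convex[OF H1] Lagrangian_mono[OF H1] B\<^sub>2(2) that by simp_all
    show "\<bar>?L x t q - ?L x s q\<bar> \<le> C\<^sub>T * \<bar>t - s\<bar>"
      if "0 < t" "t < T" "0 < s" "s < T" "q \<ge> 0" for x t s q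
      using C\<^sub>T(2) that by simp
  qed (fact T lower B\<^sub>2(1) \<Lambda>0 C\<^sub>0 Q(1) less_imp_le[OF C\<^sub>T(1)])+
  have large: "P.K * (q + 1) \<le> m q" if "q \<ge> Q" for q
    using Q(2)[OF that] by (simp add: P.K_def K_def)
  have perron: "bounded_Monge_solution_with_data T H u0 P.perron"
    using P.perron_solves[OF \<open>bounded (range u0)\<close> large] by simp
  have initial: "v (x, 0) = u0 x" if "bounded_Monge_solution_with_data T H u0 v" for v x
    by (rule initial_value[OF T]) (use that in \<open>simp_all add: bounded_Monge_solution_with_data_def\<close>)
  have le: "v (x, t) \<le> w (x, t)"
    if v: "bounded_Monge_solution_with_data T H u0 v" and w: "bounded_Monge_solution_with_data T H u0 w"
      and t: "0 \<le> t" "t < T" for v w :: "'a \<times> real \<Rightarrow> real" and x t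
  proof (rule Monge_comparison[where L = ?L and m = m and T = T])
    show "Lip (UNIV \<times> {0..<T}) v" "Lip (UNIV \<times> {0..<T}) w"
      using v w by (simp_all add: bounded_Monge_solution_with_data_def)
    show "v (x, 0) \<le> w (x, 0)" for x
      using initial[OF v] initial[OF w] by simp
  qed (fact lower m(2) t solution_is_semisolution(1)[OF v] solution_is_semisolution(2)[OF w])+
  show ?thesis
  proof (intro exI[of _ P.perron] conjI allI impI ballI perron)
    fix w :: "'a \<times> real \<Rightarrow> real" and z :: "'a \<times> real"
    assume w: "bounded_Monge_solution_with_data T H u0 w" and "z \<in> UNIV \<times> {0..<T}"
    then obtain x t where "z = (x, t)" "0 \<le> t" "t < T" by auto
    then show "w z = P.perron z" using le[OF perron w, of t x] le[OF w perron, of t x] by simp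
  qed
qed

end
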